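(* Let $M$ be a $(2n+s)$-dimensional $S$-manifold with $n\geq 2$, endowed with the semi-symmetric non-metric connection $$\widetilde\nabla_XY=\nabla_XY+\sum_{j=1}^s\eta^j(Y)X,$$ where $\nabla$ is the Riemannian (Levi-Civita) connection of $g$. If the $\mathcal{L}$-sectional curvature $\widetilde K_{\mathcal{L}}$ of $\widetilde\nabla$ is constant equal to $c$, then $c=s$. In this case, the scalar curvature of $M$ with respect to $\widetilde\nabla$ is $$\widetilde\tau=2ns(n+1)+\frac{s(s-1)}{2}.$$
   Context: A metric $f$-manifold is a $(2n+s)$-dimensional differentiable manifold $M$ ($n,s\geq 1$) with a $(1,1)$ tensor field $f$, vector fields $\xi_1,\dots,\xi_s$ (structure vector fields), 1-forms $\eta^1,\dots,\eta^s$ and a Riemannian metric $g$ such that $f^2=-I+\sum_{\alpha=1}^s\eta^\alpha\otimes\xi_\alpha$, $\eta^\alpha(\xi_\beta)=\delta_{\alpha\beta}$, $f\xi_\alpha=0$, $\eta^\alpha\circ f=0$, $g(fX,fY)=g(X,Y)-\sum_{\alpha=1}^s\eta^\alpha(X)\eta^\alpha(Y)$; moreover $\eta^\alpha(X)=g(X,\xi_\alpha)$ and $g(X,fY)=-g(fX,Y)$. The fundamental 2-form is $\Phi(X,Y)=g(X,fY)$. $M$ is an $S$-manifold if it is normal, i.e. $[f,f]+2\sum_{\alpha=1}^s d\eta^\alpha\otimes\xi_\alpha=0$ with $[f,f](X,Y)=f^2[X,Y]+[fX,fY]-f[fX,Y]-f[X,fY]$, and for every $1\leq\alpha\leq s$: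 $\eta^1\wedge\cdots\wedge\eta^s\wedge(d\eta^\alpha)^n\neq 0$ everywhere and $\Phi=d\eta^\alpha$. Convention: $d\eta(X,Y)=\frac12\left(X\eta(Y)-Y\eta(X)-\eta([X,Y])\right)$. $\mathcal{L}$ is the distribution orthogonal to the span of $\xi_1,\dots,\xi_s$. The curvature of $\widetilde\nabla$ is $\widetilde R(X,Y)Z=\widetilde\nabla_X\widetilde\nabla_YZ-\widetilde\nabla_Y\widetilde\nabla_XZ-\widetilde\nabla_{[X,Y]}Z$, with $\widetilde R(X,Y,Z,W)=g(\widetilde R(X,Y)Z,W)$; for orthonormal $X,Y$ put $\widetilde K(X,Y)=\widetilde R(X,Y,Y,X)$ (in general not symmetric in $X,Y$). The $\mathcal{L}$-sectional curvature of $\widetilde\nabla$ is $\widetilde K_{\mathcal{L}}(X,Y)=\widetilde K(X,Y)$ for orthonormal $X,Y\in\mathcal{L}$; it is constant equal to $c$ if this value is $c$ at every point and for all orthonormal $X,Y\in\mathcal{L}$. The scalar curvature with respect to $\widetilde\nabla$ is $\widetilde\tau=\frac12\sum_{i,j=1}^{2n+s}\widetilde K(e_i,e_j)$ (sum over ordered pairs) for any local orthonormal frame $\{e_1,\dots,e_{2n+s}\}$, the terms with $i=j$ being zero. *)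

theory Defs
  imports "HOL-Analysis.Analysis"
begin

section \<open>Smooth maps between Euclidean spaces\<close>

primrec times_continuously_differentiable_on ::
  "nat \<Rightarrow> 'e::euclidean_space set \<Rightarrow> ('e \<Rightarrow> 'b::real_normed_vector) \<Rightarrow> bool" where
  "times_continuously_differentiable_on 0 S h \<longleftrightarrow> continuous_on S h"
| "times_continuously_differentiable_on (Suc k) S h \<longleftrightarrow>
     (\<forall>x\<in>S. h differentiable (at x)) \<and>
     (\<forall>v. times_continuously_differentiable_on k S (\<lambda>x. frechet_derivative h (at x) v))"

text \<open>To be used for open \<open>S\<close> only.\<close>

definition smooth_on :: "'e::euclidean_space set \<Rightarrow> ('e \<Rightarrow> 'b::real_normed_vector) \<Rightarrow> bool" where
  "smooth_on S h \<longleftrightarrow> (\<forall>k. times_continuously_differentiable_on k S h)"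


section \<open>Smooth manifolds\<close>

text \<open>
  A chart is a pair of its domain and its coordinate map; the inverse coordinate map is
  \<open>inv_into U \<phi>\<close>. The manifold is the whole (Hausdorff, second countable) type \<open>'a\<close>, and the
  atlas \<open>A\<close> need not be maximal.
\<close>

type_synonym ('a, 'e) chart = "'a set \<times> ('a \<Rightarrow> 'e)"

locale smooth_manifold =
  fixes A :: "('a::{t2_space, second_countable_topology}, 'e::euclidean_space) chart set"
  assumes chart_domain_open: "(U, \<phi>) \<in> A \<Longrightarrow> open U"
    and chart_image_open: "(U, \<phi>) \<in> A \<Longrightarrow> open (\<phi> ` U)"
    and chart_homeomorphism: "(U, \<phi>) \<in> A \<Longrightarrow> homeomorphism U (\<phi> ` U) \<phi> (inv_into U \<phi>)"
    and charts_cover: "(\<Union>(U, \<phi>)\<in>A. U) = UNIV"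
    and transition_smooth:
      "(U, \<phi>) \<in> A \<Longrightarrow> (V, \<psi>) \<in> A \<Longrightarrow> smooth_on (\<phi> ` (U \<inter> V)) (\<psi> \<circ> inv_into U \<phi>)"

definition smooth_functions ::
  "('a::topological_space, 'e::euclidean_space) chart set \<Rightarrow> ('a \<Rightarrow> real) set" where
  "smooth_functions A = {h. \<forall>(U, \<phi>)\<in>A. smooth_on (\<phi> ` U) (h \<circ> inv_into U \<phi>)}"

text \<open>
  The tangent space at \<open>p\<close> is represented by the vector space \<open>'e\<close>: a tangent vector at \<open>p\<close> is
  given by its components in one chosen chart \<open>chart_at A p\<close> around \<open>p\<close>. Its components in any
  other chart are obtained by applying the derivative of the transition map. A (not necessarily
  continuous) vector field is then a map \<open>'a \<Rightarrow> 'e\<close>, and a tensor at \<open>p\<close> is a (multi)linear map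
  on \<open>'e\<close>.
\<close>

definition chart_at ::
  "('a::topological_space, 'e::euclidean_space) chart set \<Rightarrow> 'a \<Rightarrow> ('a, 'e) chart" where
  "chart_at A p = (SOME c. c \<in> A \<and> p \<in> fst c)"

definition chart_components ::
  "('a::topological_space, 'e::euclidean_space) chart set \<Rightarrow> ('a, 'e) chart \<Rightarrow> 'a \<Rightarrow> 'e \<Rightarrow> 'e" where
  "chart_components A c p v =
     (case (c, chart_at A p) of ((U, \<phi>), (V, \<psi>)) \<Rightarrow>
        frechet_derivative (\<phi> \<circ> inv_into V \<psi>) (at (\<psi> p)) v)"

text \<open>The coordinate expression of a vector field in a chart, as a map on the chart image.\<close>

definition coord_field ::
  "('a::topological_space, 'e::euclidean_space) chart set \<Rightarrow> ('a, 'e) chart \<Rightarrow> ('a \<Rightarrow> 'e) \<Rightarrow> 'e \<Rightarrow> 'e"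
  where
  "coord_field A c X x =
     (let p = inv_into (fst c) (snd c) x in chart_components A c p (X p))"

definition vector_fields ::
  "('a::topological_space, 'e::euclidean_space) chart set \<Rightarrow> ('a \<Rightarrow> 'e) set" where
  "vector_fields A = {X. \<forall>(U, \<phi>)\<in>A. smooth_on (\<phi> ` U) (coord_field A (U, \<phi>) X)}"

text \<open>The function \<open>X h\<close>.\<close>

definition derivative_along ::
  "('a::topological_space, 'e::euclidean_space) chart set \<Rightarrow> ('a \<Rightarrow> 'e) \<Rightarrow> ('a \<Rightarrow> real) \<Rightarrow> 'a \<Rightarrow> real"
  where
  "derivative_along A X h p =
     (case chart_at A p of (V, \<psi>) \<Rightarrow>
        frechet_derivative (h \<circ> inv_into V \<psi>) (at (\<psi> p)) (X p))"

text \<open>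
  The bracket \<open>[X, Y] = X Y - Y X\<close>, by its expression \<open>[X, Y]\<^sup>i = X(Y\<^sup>i) - Y(X\<^sup>i)\<close> in the
  chosen chart at \<open>p\<close>.
\<close>

definition lie_bracket ::
  "('a::topological_space, 'e::euclidean_space) chart set \<Rightarrow> ('a \<Rightarrow> 'e) \<Rightarrow> ('a \<Rightarrow> 'e) \<Rightarrow> 'a \<Rightarrow> 'e" where
  "lie_bracket A X Y p =
     (let c = chart_at A p; x = snd c p; X' = coord_field A c X; Y' = coord_field A c Y
      in frechet_derivative Y' (at x) (X' x) - frechet_derivative X' (at x) (Y' x))"


section \<open>Differential forms\<close>

text \<open>
  A \<open>k\<close>-form is treated as an alternating map on vector fields; it is applied to
  \<open>X 0, \<dots>, X (k - 1)\<close>. The exterior product is normalised by \<open>1 / (k + l)!\<close>, which is the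
  normalisation that goes with the factor \<open>1 / 2\<close> in the exterior derivative.
\<close>

type_synonym ('a, 'e) form = "(nat \<Rightarrow> 'a \<Rightarrow> 'e) \<Rightarrow> 'a \<Rightarrow> real"

definition wedge :: "nat \<Rightarrow> nat \<Rightarrow> ('a, 'e) form \<Rightarrow> ('a, 'e) form \<Rightarrow> ('a, 'e) form" where
  "wedge k l \<omega> \<theta> X p =
     (\<Sum>\<sigma> | \<sigma> permutes {..<k + l}.
        of_int (sign \<sigma>) * \<omega> (\<lambda>i. X (\<sigma> i)) p * \<theta> (\<lambda>i. X (\<sigma> (k + i))) p) / fact (k + l)"

definition one_form :: "('a \<Rightarrow> 'e \<Rightarrow> real) \<Rightarrow> ('a, 'e) form" where
  "one_form \<eta> X p = \<eta> p (X 0 p)"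

definition ext_deriv ::
  "('a::topological_space, 'e::euclidean_space) chart set \<Rightarrow> ('a \<Rightarrow> 'e \<Rightarrow> real) \<Rightarrow>
     ('a \<Rightarrow> 'e) \<Rightarrow> ('a \<Rightarrow> 'e) \<Rightarrow> 'a \<Rightarrow> real" where
  "ext_deriv A \<eta> X Y p =
     1/2 * (derivative_along A X (\<lambda>q. \<eta> q (Y q)) p
            - derivative_along A Y (\<lambda>q. \<eta> q (X q)) p
            - \<eta> p (lie_bracket A X Y p))"

text \<open>\<open>\<eta>\<^sup>1 \<and> \<dots> \<and> \<eta>\<^sup>s\<close>, as an \<open>s\<close>-form.\<close>

primrec wedge_one_forms :: "(nat \<Rightarrow> 'a \<Rightarrow> 'e \<Rightarrow> real) \<Rightarrow> nat \<Rightarrow> ('a, 'e) form" where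
  "wedge_one_forms \<eta> 0 = (\<lambda>X p. 1)"
| "wedge_one_forms \<eta> (Suc s) = wedge s 1 (wedge_one_forms \<eta> s) (one_form (\<eta> (Suc s)))"

text \<open>The \<open>n\<close>-th exterior power of a 2-form, as a \<open>2 n\<close>-form.\<close>

primrec wedge_power2 :: "('a, 'e) form \<Rightarrow> nat \<Rightarrow> ('a, 'e) form" where
  "wedge_power2 \<omega> 0 = (\<lambda>X p. 1)"
| "wedge_power2 \<omega> (Suc n) = wedge (2 * n) 2 (wedge_power2 \<omega> n) \<omega>"


section \<open>Riemannian metrics, connections and curvature\<close>

locale riemannian_manifold = smooth_manifold A
  for A :: "('a::{t2_space, second_countable_topology}, 'e::euclidean_space) chart set" +
  fixes g :: "'a \<Rightarrow> 'e \<Rightarrow> 'e \<Rightarrow> real"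
  assumes metric_bilinear: "bilinear (g p)"
    and metric_sym: "g p u v = g p v u"
    and metric_pos: "v \<noteq> 0 \<Longrightarrow> g p v v > 0"
    and metric_smooth: "X \<in> vector_fields A \<Longrightarrow> Y \<in> vector_fields A \<Longrightarrow>
      (\<lambda>p. g p (X p) (Y p)) \<in> smooth_functions A"

type_synonym ('a, 'e) connection = "('a \<Rightarrow> 'e) \<Rightarrow> ('a \<Rightarrow> 'e) \<Rightarrow> 'a \<Rightarrow> 'e"

definition affine_connection ::
  "('a::topological_space, 'e::euclidean_space) chart set \<Rightarrow> ('a, 'e) connection \<Rightarrow> bool" where
  "affine_connection A nabla \<longleftrightarrow>
     (\<forall>X\<in>vector_fields A. \<forall>Y\<in>vector_fields A. nabla X Y \<in> vector_fields A) \<and>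
     (\<forall>X\<in>vector_fields A. \<forall>Y\<in>vector_fields A. \<forall>Z\<in>vector_fields A.
        nabla (\<lambda>p. X p + Y p) Z = (\<lambda>p. nabla X Z p + nabla Y Z p) \<and>
        nabla X (\<lambda>p. Y p + Z p) = (\<lambda>p. nabla X Y p + nabla X Z p)) \<and>
     (\<forall>h\<in>smooth_functions A. \<forall>X\<in>vector_fields A. \<forall>Y\<in>vector_fields A.
        nabla (\<lambda>p. h p *\<^sub>R X p) Y = (\<lambda>p. h p *\<^sub>R nabla X Y p) \<and>
        nabla X (\<lambda>p. h p *\<^sub>R Y p) = (\<lambda>p. h p *\<^sub>R nabla X Y p + derivative_along A X h p *\<^sub>R Y p))"

definition levi_civita_connection ::
  "('a::topological_space, 'e::euclidean_space) chart set \<Rightarrow> ('a \<Rightarrow> 'e \<Rightarrow> 'e \<Rightarrow> real) \<Rightarrow>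
     ('a, 'e) connection \<Rightarrow> bool" where
  "levi_civita_connection A g nabla \<longleftrightarrow>
     affine_connection A nabla \<and>
     (\<forall>X\<in>vector_fields A. \<forall>Y\<in>vector_fields A. \<forall>p.
        nabla X Y p - nabla Y X p = lie_bracket A X Y p) \<and>
     (\<forall>X\<in>vector_fields A. \<forall>Y\<in>vector_fields A. \<forall>Z\<in>vector_fields A. \<forall>p.
        derivative_along A X (\<lambda>q. g q (Y q) (Z q)) p = g p (nabla X Y p) (Z p) + g p (Y p) (nabla X Z p))"

definition curvature ::
  "('a::topological_space, 'e::euclidean_space) chart set \<Rightarrow> ('a, 'e) connection \<Rightarrow>
     ('a \<Rightarrow> 'e) \<Rightarrow> ('a \<Rightarrow> 'e) \<Rightarrow> ('a \<Rightarrow> 'e) \<Rightarrow> 'a \<Rightarrow> 'e" where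
  "curvature A nabla X Y Z p =
     nabla X (nabla Y Z) p - nabla Y (nabla X Z) p - nabla (lie_bracket A X Y) Z p"

text \<open>
  The curvature on tangent vectors at \<open>p\<close>: the common value of \<open>curvature A nabla X Y Z p\<close> over all
  smooth vector fields extending \<open>u\<close>, \<open>v\<close>, \<open>w\<close>. It is well defined since the curvature of an
  affine connection is a tensor.
\<close>

definition curvature_at ::
  "('a::topological_space, 'e::euclidean_space) chart set \<Rightarrow> ('a, 'e) connection \<Rightarrow>
     'a \<Rightarrow> 'e \<Rightarrow> 'e \<Rightarrow> 'e \<Rightarrow> 'e" where
  "curvature_at A nabla p u v w =
     (THE z. \<forall>X\<in>vector_fields A. \<forall>Y\<in>vector_fields A. \<forall>Z\<in>vector_fields A.
        X p = u \<and> Y p = v \<and> Z p = w \<longrightarrow> curvature A nabla X Y Z p = z)"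

text \<open>\<open>K(u, v) = g(R(u, v)v, u)\<close>, meant for orthonormal \<open>u\<close>, \<open>v\<close>.\<close>

definition sectional_curvature ::
  "('a::topological_space, 'e::euclidean_space) chart set \<Rightarrow> ('a \<Rightarrow> 'e \<Rightarrow> 'e \<Rightarrow> real) \<Rightarrow>
     ('a, 'e) connection \<Rightarrow> 'a \<Rightarrow> 'e \<Rightarrow> 'e \<Rightarrow> real" where
  "sectional_curvature A g nabla p u v = g p (curvature_at A nabla p u v v) u"

text \<open>An orthonormal basis \<open>e 1, \<dots>, e m\<close> (\<open>m\<close> the dimension) of the tangent space at \<open>p\<close>.\<close>

definition orthonormal_frame_at ::
  "('a \<Rightarrow> 'e::euclidean_space \<Rightarrow> 'e \<Rightarrow> real) \<Rightarrow> 'a \<Rightarrow> (nat \<Rightarrow> 'e) \<Rightarrow> bool" where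
  "orthonormal_frame_at g p e \<longleftrightarrow>
     (\<forall>i\<in>{1..DIM('e)}. \<forall>j\<in>{1..DIM('e)}. g p (e i) (e j) = (if i = j then 1 else 0))"

text \<open>
  The scalar curvature at \<open>p\<close> computed in the frame \<open>e\<close>. The terms with \<open>i = j\<close> vanish because
  the curvature is antisymmetric in its first two arguments.
\<close>

definition scalar_curvature ::
  "('a::topological_space, 'e::euclidean_space) chart set \<Rightarrow> ('a \<Rightarrow> 'e \<Rightarrow> 'e \<Rightarrow> real) \<Rightarrow>
     ('a, 'e) connection \<Rightarrow> 'a \<Rightarrow> (nat \<Rightarrow> 'e) \<Rightarrow> real" where
  "scalar_curvature A g nabla p e =
     1/2 * (\<Sum>i=1..DIM('e). \<Sum>j=1..DIM('e). sectional_curvature A g nabla p (e i) (e j))"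


section \<open>Metric f-manifolds and S-manifolds\<close>

text \<open>
  The indices \<open>\<alpha>\<close> range over \<open>{1..s}\<close>; the values of \<open>\<xi>\<close> and \<open>\<eta>\<close> at other indices are irrelevant.
\<close>

locale metric_f_manifold = riemannian_manifold A g
  for A :: "('a::{t2_space, second_countable_topology}, 'e::euclidean_space) chart set"
    and g :: "'a \<Rightarrow> 'e \<Rightarrow> 'e \<Rightarrow> real" +
  fixes n s :: nat
    and f :: "'a \<Rightarrow> 'e \<Rightarrow> 'e"
    and \<xi> :: "nat \<Rightarrow> 'a \<Rightarrow> 'e"
    and \<eta> :: "nat \<Rightarrow> 'a \<Rightarrow> 'e \<Rightarrow> real"
  assumes n_pos: "n \<ge> 1" and s_pos: "s \<ge> 1"
    and dimension: "DIM('e) = 2 * n + s"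
    and f_linear: "linear (f p)"
    and f_smooth: "X \<in> vector_fields A \<Longrightarrow> (\<lambda>p. f p (X p)) \<in> vector_fields A"
    and xi_smooth: "\<alpha> \<in> {1..s} \<Longrightarrow> \<xi> \<alpha> \<in> vector_fields A"
    and eta_linear: "\<alpha> \<in> {1..s} \<Longrightarrow> linear (\<eta> \<alpha> p)"
    and eta_smooth: "\<alpha> \<in> {1..s} \<Longrightarrow> X \<in> vector_fields A \<Longrightarrow>
      (\<lambda>p. \<eta> \<alpha> p (X p)) \<in> smooth_functions A"
    and f_squared: "f p (f p v) = - v + (\<Sum>\<alpha>=1..s. \<eta> \<alpha> p v *\<^sub>R \<xi> \<alpha> p)"
    and eta_xi: "\<alpha> \<in> {1..s} \<Longrightarrow> \<beta> \<in> {1..s} \<Longrightarrow> \<eta> \<alpha> p (\<xi> \<beta> p) = (if \<alpha> = \<beta> then 1 else 0)"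
    and f_xi: "\<alpha> \<in> {1..s} \<Longrightarrow> f p (\<xi> \<alpha> p) = 0"
    and eta_f: "\<alpha> \<in> {1..s} \<Longrightarrow> \<eta> \<alpha> p (f p v) = 0"
    and metric_f_f: "g p (f p u) (f p v) = g p u v - (\<Sum>\<alpha>=1..s. \<eta> \<alpha> p u * \<eta> \<alpha> p v)"
    and eta_metric: "\<alpha> \<in> {1..s} \<Longrightarrow> \<eta> \<alpha> p v = g p v (\<xi> \<alpha> p)"
    and f_skew: "g p u (f p v) = - g p (f p u) v"

definition fundamental_form ::
  "('a \<Rightarrow> 'e \<Rightarrow> 'e \<Rightarrow> real) \<Rightarrow> ('a \<Rightarrow> 'e \<Rightarrow> 'e) \<Rightarrow> ('a \<Rightarrow> 'e) \<Rightarrow> ('a \<Rightarrow> 'e) \<Rightarrow> 'a \<Rightarrow> real" where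
  "fundamental_form g f X Y p = g p (X p) (f p (Y p))"

definition nijenhuis ::
  "('a::topological_space, 'e::euclidean_space) chart set \<Rightarrow> ('a \<Rightarrow> 'e \<Rightarrow> 'e) \<Rightarrow>
     ('a \<Rightarrow> 'e) \<Rightarrow> ('a \<Rightarrow> 'e) \<Rightarrow> 'a \<Rightarrow> 'e" where
  "nijenhuis A f X Y p =
     f p (f p (lie_bracket A X Y p))
     + lie_bracket A (\<lambda>q. f q (X q)) (\<lambda>q. f q (Y q)) p
     - f p (lie_bracket A (\<lambda>q. f q (X q)) Y p)
     - f p (lie_bracket A X (\<lambda>q. f q (Y q)) p)"

locale S_manifold = metric_f_manifold A g n s f \<xi> \<eta>
  for A :: "('a::{t2_space, second_countable_topology}, 'e::euclidean_space) chart set"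
    and g :: "'a \<Rightarrow> 'e \<Rightarrow> 'e \<Rightarrow> real"
    and n s :: nat
    and f :: "'a \<Rightarrow> 'e \<Rightarrow> 'e"
    and \<xi> :: "nat \<Rightarrow> 'a \<Rightarrow> 'e"
    and \<eta> :: "nat \<Rightarrow> 'a \<Rightarrow> 'e \<Rightarrow> real" +
  assumes normal: "X \<in> vector_fields A \<Longrightarrow> Y \<in> vector_fields A \<Longrightarrow>
      nijenhuis A f X Y p + 2 *\<^sub>R (\<Sum>\<alpha>=1..s. ext_deriv A (\<eta> \<alpha>) X Y p *\<^sub>R \<xi> \<alpha> p) = 0"
    and volume_nonzero: "\<alpha> \<in> {1..s} \<Longrightarrow>
      \<exists>X. (\<forall>i. X i \<in> vector_fields A) \<and>
        wedge s (2 * n) (wedge_one_forms \<eta> s)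
          (wedge_power2 (\<lambda>Z. ext_deriv A (\<eta> \<alpha>) (Z 0) (Z 1)) n) X p \<noteq> 0"
    and fundamental_form_eq: "\<alpha> \<in> {1..s} \<Longrightarrow> X \<in> vector_fields A \<Longrightarrow> Y \<in> vector_fields A \<Longrightarrow>
      fundamental_form g f X Y p = ext_deriv A (\<eta> \<alpha>) X Y p"

text \<open>The distribution \<open>\<L>\<close> orthogonal to the structure vector fields.\<close>

definition L_distribution ::
  "('a \<Rightarrow> 'e \<Rightarrow> 'e \<Rightarrow> real) \<Rightarrow> nat \<Rightarrow> (nat \<Rightarrow> 'a \<Rightarrow> 'e) \<Rightarrow> 'a \<Rightarrow> 'e set" where
  "L_distribution g s \<xi> p = {v. \<forall>\<alpha>\<in>{1..s}. g p v (\<xi> \<alpha> p) = 0}"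

definition constant_L_sectional_curvature ::
  "('a::topological_space, 'e::euclidean_space) chart set \<Rightarrow> ('a \<Rightarrow> 'e \<Rightarrow> 'e \<Rightarrow> real) \<Rightarrow> nat \<Rightarrow>
     (nat \<Rightarrow> 'a \<Rightarrow> 'e) \<Rightarrow> ('a, 'e) connection \<Rightarrow> real \<Rightarrow> bool" where
  "constant_L_sectional_curvature A g s \<xi> nabla c \<longleftrightarrow>
     (\<forall>p. \<forall>u\<in>L_distribution g s \<xi> p. \<forall>v\<in>L_distribution g s \<xi> p.
        g p u u = 1 \<and> g p v v = 1 \<and> g p u v = 0 \<longrightarrow> sectional_curvature A g nabla p u v = c)"

definition semi_symmetric_non_metric_connection ::
  "nat \<Rightarrow> (nat \<Rightarrow> 'a \<Rightarrow> 'e \<Rightarrow> real) \<Rightarrow> ('a, 'e::euclidean_space) connection \<Rightarrow> ('a, 'e) connection" where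
  "semi_symmetric_non_metric_connection s \<eta> nabla X Y p =
     nabla X Y p + (\<Sum>j=1..s. \<eta> j p (Y p)) *\<^sub>R X p"

end

theory Submission
  imports Defs
begin

text \<open>
  Write \<open>\<eta>\<close> and \<open>\<xi>\<close> for the sums of the structure forms and fields, and \<open>h(X, Y) = g(fX, fY)\<close>. Normality and
  \<open>\<Phi> = d\<eta>\<^sup>\<alpha>\<close> make each \<open>\<xi>\<^sub>\<alpha>\<close> a Killing field with \<open>\<nabla>\<^sub>X \<xi>\<^sub>\<alpha> = - fX\<close>, and then force
  \<open>(\<nabla>\<^sub>X f) Y = h(X, Y) \<xi> + \<eta>(Y) f\<^sup>2 X\<close>. Differentiating once more gives
  \<open>R(X, Y) \<xi>\<^sub>\<alpha> = \<eta>(X) f\<^sup>2 Y - \<eta>(Y) f\<^sup>2 X\<close>, and on \<open>\<L>\<close> the commutator of \<open>R(X, Y)\<close> with \<open>f\<close>, which is \<open>s\<close>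
  times an algebraic expression in \<open>g\<close> and \<open>f\<close>. For orthonormal vectors the sectional curvature of the semi-symmetric
  connection is \<open>K(X, Y) + \<eta>(Y)\<^sup>2\<close>, so that it is \<open>K\<close> on \<open>\<L>\<close>. If it is the constant \<open>c\<close> there, then \<open>R\<close> is
  that of a space of constant curvature on \<open>\<L>\<close>, and evaluating the commutator on unit vectors \<open>X, Y \<in> \<L>\<close> with \<open>Y\<close>
  orthogonal to \<open>X\<close> and \<open>fX\<close> (here \<open>n \<ge> 2\<close> is used) leaves \<open>c = s\<close>. Splitting along \<open>\<L>\<close> and its complement
  expresses \<open>R(X, Y, Y, X)\<close> through \<open>h\<close> and \<open>\<eta>\<close>; Parseval's identity in an orthonormal frame sums it.
\<close>

subsection \<open>Calculus of smooth maps\<close>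

text \<open>The objects are pointwise, but connections act on global fields, and the components of a
  tangent vector at \<open>p\<close> refer to \<open>chart_at A p\<close>, which may jump with
  \<open>p\<close>. Identities are therefore proved for global smooth fields, bump functions supply
  such fields through prescribed vectors, and tensoriality makes the value at a point meaningful.
  The \<open>s\<close> in \<open>c = s\<close> arises by differentiation: each of the
  \<open>s\<close> structure fields has covariant derivative \<open>- f X\<close>, so that
  \<open>nabla X xi_sum\<close> is \<open>- s f X\<close>. Hence the commutator of the curvature
  with \<open>f\<close> carries a factor \<open>s\<close>, whereas a tensor of constant curvature
  \<open>c\<close> carries \<open>c\<close> in the same place. The frame in the scalar curvature is
  an arbitrary orthonormal one, not adapted to the splitting into \<open>L\<close> and the structure
  fields. For this reason R(u, v, v, u) is needed for all \<open>u\<close>, \<open>v\<close>, and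
  its traces are computed without choosing a better frame.\<close>

abbreviation C_on ::
  "nat \<Rightarrow> 'e::euclidean_space set \<Rightarrow> ('e \<Rightarrow> 'b::real_normed_vector) \<Rightarrow> bool"
  where "C_on \<equiv> times_continuously_differentiable_on"

lemma C_on_SucD:
  assumes "C_on (Suc k) S h"
  shows "x \<in> S \<Longrightarrow> (h has_derivative frechet_derivative h (at x)) (at x)"
    and "C_on k S (\<lambda>x. frechet_derivative h (at x) v)"
  using assms by (auto simp: frechet_derivative_works)

lemma C_on_cong:
  assumes "open S" "\<And>x. x \<in> S \<Longrightarrow> h x = h' x" "C_on k S h"
  shows "C_on k S h'"
  using assms(2,3)
proof (induction k arbitrary: h h')
  case 0
  then show ?case using continuous_on_cong[of S S h h'] by simp
next
  case (Suc k)
  have d: "(h' has_derivative frechet_derivative h (at x)) (at x)" if "x \<in> S" for x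
    using has_derivative_transform_within_open[OF C_on_SucD(1)[OF Suc.prems(2) that] \<open>open S\<close> that]
      Suc.prems(1) by blast
  have eq: "frechet_derivative h (at x) = frechet_derivative h' (at x)" if "x \<in> S" for x
    using frechet_derivative_at[OF d[OF that]] .
  have "C_on k S (\<lambda>x. frechet_derivative h' (at x) v)" for v
    using Suc.IH[of "\<lambda>x. frechet_derivative h (at x) v" "\<lambda>x. frechet_derivative h' (at x) v"]
      C_on_SucD(2)[OF Suc.prems(2)] eq by simp
  then show ?case using d by (auto simp: differentiable_def)
qed

lemma C_on_SucI:
  assumes "open S" "\<And>x. x \<in> S \<Longrightarrow> (h has_derivative D x) (at x)" "\<And>v. C_on k S (\<lambda>x. D x v)"
  shows "C_on (Suc k) S h"
proof -
  have "C_on k S (\<lambda>x. frechet_derivative h (at x) v)" for v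
    by (rule C_on_cong[OF assms(1) _ assms(3)[of v]])
      (use frechet_derivative_at[OF assms(2)] in simp)
  then show ?thesis using assms(2) by (auto simp: differentiable_def)
qed

lemma C_on_subset: "C_on k S h \<Longrightarrow> T \<subseteq> S \<Longrightarrow> C_on k T h"
  by (induction k arbitrary: h) (auto intro: continuous_on_subset)

lemma C_on_Un:
  assumes "open S" "open T" "C_on k S h" "C_on k T h"
  shows "C_on k (S \<union> T) h"
  using assms(3,4)
  by (induction k arbitrary: h) (auto intro: continuous_on_open_Un assms(1,2))

lemma C_on_continuous: "C_on k S h \<Longrightarrow> continuous_on S h"
  by (cases k) (auto intro!: continuous_at_imp_continuous_on differentiable_imp_continuous_within)

lemma C_on_Suc_lower: "C_on (Suc k) S h \<Longrightarrow> C_on k S h"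
proof (induction k arbitrary: h)
  case 0
  then show ?case using C_on_continuous[of "Suc 0"] by simp
next
  case (Suc k)
  have "C_on k S (\<lambda>x. frechet_derivative h (at x) v)" for v
    using Suc.IH C_on_SucD(2)[OF Suc.prems] by blast
  with Suc.prems show ?case by simp
qed

lemma C_on_const: "C_on k S (\<lambda>x. c)"
  by (induction k arbitrary: c) auto

lemma C_on_add:
  assumes "open S" "C_on k S h" "C_on k S h'"
  shows "C_on k S (\<lambda>x. h x + h' x)"
  using assms(2,3)
proof (induction k arbitrary: h h')
  case 0
  then show ?case by (auto intro: continuous_on_add)
next
  case (Suc k)
  show ?case
    by (rule C_on_SucI[OF assms(1) has_derivative_add[OF C_on_SucD(1) C_on_SucD(1)]])
      (use Suc C_on_SucD in blast)+
qed

lemma C_on_bounded_linear: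
  assumes "open S" "bounded_linear L" "C_on k S h"
  shows "C_on k S (\<lambda>x. L (h x))"
  using assms(3)
proof (induction k arbitrary: h)
  case 0
  then show ?case using assms(2) by (auto intro: bounded_linear.continuous_on)
next
  case (Suc k)
  show ?case
    by (rule C_on_SucI[OF assms(1) bounded_linear.has_derivative[OF assms(2) C_on_SucD(1)]])
      (use Suc C_on_SucD in blast)+
qed

text \<open>The product rule pairs each undifferentiated factor with a derivative of the other, so
  the induction also needs both factors at one order lower.\<close>

lemma C_on_bounded_bilinear:
  assumes "open S" "bounded_bilinear mul" "C_on k S h" "C_on k S h'"
  shows "C_on k S (\<lambda>x. mul (h x) (h' x))"
  using assms(3,4)
proof (induction k arbitrary: h h')
  case 0
  then show ?case using assms(2) by (auto intro: bounded_bilinear.continuous_on)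
next
  case (Suc k)
  note low = C_on_Suc_lower[OF Suc.prems(1)] C_on_Suc_lower[OF Suc.prems(2)]
  show ?case
  proof (rule C_on_SucI[OF assms(1)
        bounded_bilinear.FDERIV[OF assms(2) C_on_SucD(1)[OF Suc.prems(1)] C_on_SucD(1)[OF Suc.prems(2)]]])
    show "C_on k S (\<lambda>x. mul (h x) (frechet_derivative h' (at x) v)
        + mul (frechet_derivative h (at x) v) (h' x))" for v
      by (intro C_on_add[OF assms(1)] Suc.IH low C_on_SucD(2)[OF Suc.prems(1)] C_on_SucD(2)[OF Suc.prems(2)])
  qed
qed

lemma C_on_sum:
  assumes "open S" "finite I" "\<And>i. i \<in> I \<Longrightarrow> C_on k S (h i)"
  shows "C_on k S (\<lambda>x. \<Sum>i\<in>I. h i x)"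
  using assms(2,3)
  by (induction I rule: finite_induct) (auto intro: C_on_const C_on_add[OF assms(1)])

text \<open>\<open>times_continuously_differentiable_on\<close> controls derivatives in fixed
  directions only. Expanding in \<open>Basis\<close> reduces a derivative in a moving direction, as
  in the chain rule, to these.\<close>

lemma linear_Basis_expansion:
  fixes L :: "'e::euclidean_space \<Rightarrow> 'b::real_vector"
  assumes "linear L"
  shows "L v = (\<Sum>b\<in>Basis. (v \<bullet> b) *\<^sub>R L b)"
proof -
  have "L v = L (\<Sum>b\<in>Basis. (v \<bullet> b) *\<^sub>R b)" by (simp add: euclidean_representation)
  then show ?thesis by (simp add: linear_sum[OF assms] linear_scale[OF assms])
qed

lemma C_on_compose:
  fixes F :: "'d::euclidean_space \<Rightarrow> 'b::real_normed_vector"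
    and G :: "'e::euclidean_space \<Rightarrow> 'd"
  assumes "open S" "open T" "G ` S \<subseteq> T" "C_on k S G" "C_on k T F"
  shows "C_on k S (\<lambda>x. F (G x))"
  using assms(4,5)
proof (induction k arbitrary: F)
  case 0
  then show ?case using assms(3) by (auto intro: continuous_on_compose2)
next
  case (Suc k)
  let ?DF = "\<lambda>y. frechet_derivative F (at y)" and ?DG = "\<lambda>x. frechet_derivative G (at x)"
  have d: "((\<lambda>x. F (G x)) has_derivative (\<lambda>v. ?DF (G x) (?DG x v))) (at x)" if "x \<in> S" for x
    by (rule has_derivative_compose[OF C_on_SucD(1)[OF Suc.prems(1) that]])
      (use C_on_SucD(1)[OF Suc.prems(2)] assms(3) that in blast)
  have e: "?DF (G x) (?DG x v) = (\<Sum>b\<in>Basis. (?DG x v \<bullet> b) *\<^sub>R ?DF (G x) b)" if "x \<in> S" for x v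
    by (rule linear_Basis_expansion)
      (use C_on_SucD(1)[OF Suc.prems(2)] assms(3) that in \<open>blast intro: has_derivative_linear\<close>)
  have "C_on k S (\<lambda>x. \<Sum>b\<in>Basis. (?DG x v \<bullet> b) *\<^sub>R ?DF (G x) b)" for v
  proof (intro C_on_sum[OF assms(1)] C_on_bounded_bilinear[OF assms(1) bounded_bilinear_scaleR])
    fix b :: 'd
    show "C_on k S (\<lambda>x. ?DG x v \<bullet> b)"
      by (rule C_on_bounded_linear[OF assms(1) bounded_linear_inner_left C_on_SucD(2)[OF Suc.prems(1)]])
    show "C_on k S (\<lambda>x. ?DF (G x) b)"
      by (rule Suc.IH[OF C_on_Suc_lower[OF Suc.prems(1)] C_on_SucD(2)[OF Suc.prems(2)]])
  qed simp
  then have "C_on k S (\<lambda>x. ?DF (G x) (?DG x v))" for v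
    by (rule C_on_cong[OF assms(1), rotated]) (simp add: e)
  from C_on_SucI[OF assms(1) d this] show ?case .
qed

lemma C_on_linear:
  fixes L :: "'e::euclidean_space \<Rightarrow> 'b::real_normed_vector"
  assumes "bounded_linear L"
  shows "C_on k S L"
proof (cases k)
  case 0
  then show ?thesis using assms by (simp add: linear_continuous_on)
next
  case (Suc m)
  have "C_on (Suc m) UNIV L"
    by (rule C_on_SucI[OF _ bounded_linear_imp_has_derivative[OF assms]]) (auto intro: C_on_const)
  then show ?thesis using Suc C_on_subset by blast
qed

section \<open>Closure properties of smooth maps\<close>

lemma smooth_on_cong:
  assumes "open S" "\<And>x. x \<in> S \<Longrightarrow> h x = h' x" "smooth_on S h"
  shows "smooth_on S h'"
  using assms C_on_cong unfolding smooth_on_def by blast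

lemma smooth_on_subset: "smooth_on S h \<Longrightarrow> T \<subseteq> S \<Longrightarrow> smooth_on T h"
  using C_on_subset unfolding smooth_on_def by blast

lemma smooth_on_Un: "open S \<Longrightarrow> open T \<Longrightarrow> smooth_on S h \<Longrightarrow> smooth_on T h \<Longrightarrow> smooth_on (S \<union> T) h"
  using C_on_Un unfolding smooth_on_def by blast

lemma smooth_on_const: "smooth_on S (\<lambda>x. c)"
  by (simp add: smooth_on_def C_on_const)

lemma smooth_on_linear: "bounded_linear L \<Longrightarrow> smooth_on S L"
  by (simp add: smooth_on_def C_on_linear)

lemma smooth_on_add:
  "open S \<Longrightarrow> smooth_on S h \<Longrightarrow> smooth_on S h' \<Longrightarrow> smooth_on S (\<lambda>x. h x + h' x)"
  by (simp add: smooth_on_def C_on_add)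

lemma smooth_on_sum:
  "open S \<Longrightarrow> finite I \<Longrightarrow> (\<And>i. i \<in> I \<Longrightarrow> smooth_on S (h i)) \<Longrightarrow> smooth_on S (\<lambda>x. \<Sum>i\<in>I. h i x)"
  by (simp add: smooth_on_def C_on_sum)

lemma smooth_on_bounded_linear:
  "open S \<Longrightarrow> bounded_linear L \<Longrightarrow> smooth_on S h \<Longrightarrow> smooth_on S (\<lambda>x. L (h x))"
  by (simp add: smooth_on_def C_on_bounded_linear)

lemma smooth_on_scaleR:
  "open S \<Longrightarrow> smooth_on S h \<Longrightarrow> smooth_on S h' \<Longrightarrow> smooth_on S (\<lambda>x. h x *\<^sub>R h' x)"
  by (simp add: smooth_on_def C_on_bounded_bilinear bounded_bilinear_scaleR)

lemma smooth_on_mult: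
  fixes h h' :: "'e::euclidean_space \<Rightarrow> real"
  shows "open S \<Longrightarrow> smooth_on S h \<Longrightarrow> smooth_on S h' \<Longrightarrow> smooth_on S (\<lambda>x. h x * h' x)"
  using smooth_on_scaleR[of S h h'] by simp

lemma smooth_on_compose:
  fixes F :: "'d::euclidean_space \<Rightarrow> 'b::real_normed_vector"
    and G :: "'e::euclidean_space \<Rightarrow> 'd"
  assumes "open S" "open T" "G ` S \<subseteq> T" "smooth_on S G" "smooth_on T F"
  shows "smooth_on S (\<lambda>x. F (G x))"
  using assms C_on_compose unfolding smooth_on_def by blast

lemma smooth_on_frechet_derivative:
  assumes "smooth_on S h"
  shows "x \<in> S \<Longrightarrow> (h has_derivative frechet_derivative h (at x)) (at x)"
    and "smooth_on S (\<lambda>x. frechet_derivative h (at x) v)"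
  using C_on_SucD assms unfolding smooth_on_def by blast+

lemma smooth_on_differentiable: "smooth_on S h \<Longrightarrow> x \<in> S \<Longrightarrow> h differentiable (at x)"
  using smooth_on_frechet_derivative(1) unfolding differentiable_def by blast

lemma smooth_on_frechet_derivative_apply:
  fixes h :: "'e::euclidean_space \<Rightarrow> 'b::real_normed_vector"
  assumes "open S" "smooth_on S h" "smooth_on S V"
  shows "smooth_on S (\<lambda>x. frechet_derivative h (at x) (V x))"
proof -
  have e: "(\<Sum>b\<in>Basis. (V x \<bullet> b) *\<^sub>R frechet_derivative h (at x) b) = frechet_derivative h (at x) (V x)"
    if "x \<in> S" for x
    by (rule linear_Basis_expansion[OF has_derivative_linear, symmetric])
      (rule smooth_on_frechet_derivative(1)[OF assms(2) that])
  have "smooth_on S (\<lambda>x. \<Sum>b\<in>Basis. (V x \<bullet> b) *\<^sub>R frechet_derivative h (at x) b)"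
    using assms by (intro smooth_on_sum smooth_on_scaleR smooth_on_frechet_derivative(2)
        smooth_on_bounded_linear[OF _ bounded_linear_inner_left]) auto
  from smooth_on_cong[OF assms(1) e this] show ?thesis .
qed

text \<open>Symmetry of the second derivative follows by applying the mean value theorem twice to the second difference.\<close>

lemma second_difference_mean_value:
  fixes F :: "'e::euclidean_space \<Rightarrow> real"
  assumes F: "smooth_on (ball x r) F" and t: "t > 0" "t * (norm u + norm v) < r"
  shows "\<exists>y\<in>ball x r. F (x + t *\<^sub>R u + t *\<^sub>R v) - F (x + t *\<^sub>R u) - F (x + t *\<^sub>R v) + F x
     = t * (t * frechet_derivative (\<lambda>z. frechet_derivative F (at z) u) (at y) v)"
proof -
  let ?D = "\<lambda>z. frechet_derivative F (at z)"
  let ?H = "\<lambda>z. frechet_derivative (\<lambda>z. ?D z u) (at z)"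
  have inb: "x + a *\<^sub>R u + b *\<^sub>R v \<in> ball x r" if "0 \<le> a" "a \<le> t" "0 \<le> b" "b \<le> t" for a b
  proof -
    have "norm (a *\<^sub>R u + b *\<^sub>R v) \<le> norm (a *\<^sub>R u) + norm (b *\<^sub>R v)"
      by (rule norm_triangle_ineq)
    also have "\<dots> \<le> t * norm u + t * norm v"
      using that by (auto intro!: add_mono mult_right_mono)
    also have "\<dots> < r" using t(2) by (simp add: distrib_left)
    finally show ?thesis
      using norm_minus_cancel[of "a *\<^sub>R u + b *\<^sub>R v"] by (simp add: dist_norm algebra_simps)
  qed
  have dF: "(F has_derivative ?D z) (at z)" if "z \<in> ball x r" for z
    using smooth_on_frechet_derivative(1)[OF F that] .
  have dH: "((\<lambda>z. ?D z u) has_derivative ?H z) (at z)" if "z \<in> ball x r" for z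
    using smooth_on_frechet_derivative(1)[OF smooth_on_frechet_derivative(2)[OF F] that] .
  have lin: "linear (?D z)" "linear (?H z)" if "z \<in> ball x r" for z
    using dF[OF that] dH[OF that] has_derivative_linear by blast+
  \<comment> \<open>The summand \<open>0 *\<^sub>R v\<close> is kept so that \<open>d1\<close>
    covers both terms, with \<open>b = t\<close> and with \<open>b = 0\<close>.\<close>
  define \<phi> where "\<phi> a = F (x + a *\<^sub>R u + t *\<^sub>R v) - F (x + a *\<^sub>R u + 0 *\<^sub>R v)" for a
  have d1: "((\<lambda>a. F (x + a *\<^sub>R u + b *\<^sub>R v)) has_derivative
      (\<lambda>h. ?D (x + a *\<^sub>R u + b *\<^sub>R v) (h *\<^sub>R u))) (at a)" if "0 \<le> a" "a \<le> t" "0 \<le> b" "b \<le> t" for a b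
    by (rule has_derivative_compose[where g = F and f = "\<lambda>a. x + a *\<^sub>R u + b *\<^sub>R v", OF _ dF[OF inb[OF that]]])
      (auto intro!: derivative_eq_intros)
  have "\<exists>a\<in>{0<..<t}. \<phi> t - \<phi> 0 = ?D (x + a *\<^sub>R u + t *\<^sub>R v) ((t - 0) *\<^sub>R u) - ?D (x + a *\<^sub>R u + 0 *\<^sub>R v) ((t - 0) *\<^sub>R u)"
    unfolding \<phi>_def
    by (rule mvt_simple[OF t(1)], rule has_derivative_at_withinI, rule has_derivative_diff; rule d1)
      (use t(1) in auto)
  then obtain a where a: "0 < a" "a < t"
    and "\<phi> t - \<phi> 0 = ?D (x + a *\<^sub>R u + t *\<^sub>R v) (t *\<^sub>R u) - ?D (x + a *\<^sub>R u + 0 *\<^sub>R v) (t *\<^sub>R u)"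
    by auto
  moreover have "?D (x + a *\<^sub>R u + b *\<^sub>R v) (t *\<^sub>R u) = t * ?D (x + a *\<^sub>R u + b *\<^sub>R v) u"
    if "0 \<le> b" "b \<le> t" for b
    using linear_scale[OF lin(1)[OF inb]] a that by simp
  ultimately have A: "\<phi> t - \<phi> 0 = t * (?D (x + a *\<^sub>R u + t *\<^sub>R v) u - ?D (x + a *\<^sub>R u + 0 *\<^sub>R v) u)"
    using t(1) by (simp only: right_diff_distrib order.refl less_imp_le)
  have "\<exists>b\<in>{0<..<t}. ?D (x + a *\<^sub>R u + t *\<^sub>R v) u - ?D (x + a *\<^sub>R u + 0 *\<^sub>R v) u
      = ?H (x + a *\<^sub>R u + b *\<^sub>R v) ((t - 0) *\<^sub>R v)"
    by (rule mvt_simple[OF t(1)], rule has_derivative_at_withinI, rule has_derivative_compose[where g = "\<lambda>z. ?D z u" and f = "\<lambda>b. x + a *\<^sub>R u + b *\<^sub>R v", OF _ dH[OF inb]])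
      (use a in \<open>auto intro!: derivative_eq_intros\<close>)
  then obtain b where b: "0 < b" "b < t"
    and B: "?D (x + a *\<^sub>R u + t *\<^sub>R v) u - ?D (x + a *\<^sub>R u + 0 *\<^sub>R v) u
      = ?H (x + a *\<^sub>R u + b *\<^sub>R v) (t *\<^sub>R v)" by auto
  have y: "x + a *\<^sub>R u + b *\<^sub>R v \<in> ball x r" using inb a b by simp
  have "F (x + t *\<^sub>R u + t *\<^sub>R v) - F (x + t *\<^sub>R u) - F (x + t *\<^sub>R v) + F x = \<phi> t - \<phi> 0"
    by (simp add: \<phi>_def)
  also have "\<dots> = t * (t * ?H (x + a *\<^sub>R u + b *\<^sub>R v) v)"
    unfolding A B using linear_scale[OF lin(2)[OF y]] by simp
  finally show ?thesis using y by blast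
qed

text \<open>The second difference is symmetric in \<open>u\<close> and \<open>v\<close>, so the two
  mixed derivatives take a common value at points \<open>y\<close> and \<open>z\<close> near
  \<open>x\<close>. If they differed at \<open>x\<close>, continuity would put this value within
  half of the gap of both, which is impossible.\<close>

lemma second_derivative_symmetric:
  fixes F :: "'e::euclidean_space \<Rightarrow> real"
  assumes "open S" "x \<in> S" "smooth_on S F"
  shows "frechet_derivative (\<lambda>y. frechet_derivative F (at y) u) (at x) v
       = frechet_derivative (\<lambda>y. frechet_derivative F (at y) v) (at x) u"
proof (rule ccontr)
  define H where "H u v y = frechet_derivative (\<lambda>z. frechet_derivative F (at z) u) (at y) v" for u v y
  assume "\<not> ?thesis"
  then have e: "\<bar>H u v x - H v u x\<bar> / 2 > 0" by (simp add: H_def)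
  have "continuous_on S (H u v)" for u v
    unfolding H_def using assms(3) smooth_on_frechet_derivative(2) C_on_continuous smooth_on_def by blast
  then have c: "isCont (H u v) x" for u v
    using assms(1,2) continuous_on_eq_continuous_at by blast
  obtain r0 where r0: "r0 > 0" "ball x r0 \<subseteq> S" using assms(1,2) open_contains_ball by blast
  obtain r1 where r1: "r1 > 0" "\<And>y. y \<in> ball x r1 \<Longrightarrow> \<bar>H u v y - H u v x\<bar> < \<bar>H u v x - H v u x\<bar> / 2"
    using c[of u v] e unfolding continuous_at_eps_delta by (metis dist_commute dist_real_def mem_ball)
  obtain r2 where r2: "r2 > 0" "\<And>y. y \<in> ball x r2 \<Longrightarrow> \<bar>H v u y - H v u x\<bar> < \<bar>H u v x - H v u x\<bar> / 2"
    using c[of v u] e unfolding continuous_at_eps_delta by (metis dist_commute dist_real_def mem_ball)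
  define r where "r = min r0 (min r1 r2)"
  have r: "r > 0" using r0 r1 r2 by (simp add: r_def)
  have "ball x r \<subseteq> S" using r0(2) by (auto simp: r_def)
  then have smooth: "smooth_on (ball x r) F" by (rule smooth_on_subset[OF assms(3)])
  \<comment> \<open>Small enough for the whole parallelogram to stay in the ball; the summand 1
    keeps the denominator positive when \<open>u = v = 0\<close>.\<close>
  define t where "t = r / (2 * (norm u + norm v + 1))"
  have den: "2 * (norm u + norm v + 1) > 0" by (simp add: add_nonneg_pos)
  have t: "t > 0" using r den by (simp add: t_def)
  have "t * (norm u + norm v) < t * (2 * (norm u + norm v + 1))"
    using t by (intro mult_strict_left_mono) (auto simp: add_nonneg_pos)
  also have "\<dots> = r" using den unfolding t_def
    by (metis less_irrefl nonzero_divide_eq_eq)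
  finally have tr: "t * (norm u + norm v) < r" .
  obtain y where y: "y \<in> ball x r" and 1: "F (x + t *\<^sub>R u + t *\<^sub>R v) - F (x + t *\<^sub>R u) - F (x + t *\<^sub>R v) + F x
     = t * (t * H u v y)"
    using second_difference_mean_value[OF smooth t tr] unfolding H_def by blast
  obtain z where z: "z \<in> ball x r" and 2: "F (x + t *\<^sub>R v + t *\<^sub>R u) - F (x + t *\<^sub>R v) - F (x + t *\<^sub>R u) + F x
     = t * (t * H v u z)"
    using second_difference_mean_value[OF smooth t, of v u] tr unfolding H_def by (auto simp: add.commute)
  have "t * (t * H u v y) = t * (t * H v u z)"
    using 1 2 by (simp add: algebra_simps)
  then have "H u v y = H v u z" using t by simp
  moreover have "\<bar>H u v y - H u v x\<bar> < \<bar>H u v x - H v u x\<bar> / 2"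
    "\<bar>H v u z - H v u x\<bar> < \<bar>H u v x - H v u x\<bar> / 2"
    using r1(2) r2(2) y z by (auto simp: r_def)
  ultimately show False by (simp add: abs_if split: if_splits)
qed

text \<open>Product rule for \<open>F'(V)\<close>. Symmetry moves the fixed vector \<open>w\<close>
  into the inner derivative, so that in a commutator of two fields the second-order terms can again
  be compared by symmetry.\<close>

lemma frechet_derivative_apply_field:
  fixes F :: "'e::euclidean_space \<Rightarrow> real"
  assumes "open S" "x \<in> S" "smooth_on S F" "smooth_on S V"
  shows "frechet_derivative (\<lambda>y. frechet_derivative F (at y) (V y)) (at x) w =
    frechet_derivative F (at x) (frechet_derivative V (at x) w)
    + frechet_derivative (\<lambda>y. frechet_derivative F (at y) w) (at x) (V x)"
proof -
  let ?D = "\<lambda>y. frechet_derivative F (at y)"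
  let ?H = "\<lambda>u. frechet_derivative (\<lambda>y. ?D y u) (at x)"
  let ?DV = "frechet_derivative V (at x)"
  have lin: "linear (?D y)" if "y \<in> S" for y
    using smooth_on_frechet_derivative(1)[OF assms(3) that] has_derivative_linear by blast
  have H: "((\<lambda>y. ?D y u) has_derivative ?H u) (at x)" for u
    using smooth_on_frechet_derivative(1)[OF smooth_on_frechet_derivative(2)[OF assms(3)] assms(2)] .
  have V: "((\<lambda>y. V y \<bullet> b) has_derivative (\<lambda>w. ?DV w \<bullet> b)) (at x)" for b
    by (rule has_derivative_inner_left[OF smooth_on_frechet_derivative(1)[OF assms(4,2)]])
  have sum: "((\<lambda>y. \<Sum>b\<in>Basis. (V y \<bullet> b) * ?D y b) has_derivative
      (\<lambda>w. \<Sum>b\<in>Basis. (V x \<bullet> b) * ?H b w + (?DV w \<bullet> b) * ?D x b)) (at x)"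
    by (rule has_derivative_sum, rule has_derivative_mult[OF V H])
  have "(\<Sum>b\<in>Basis. (V y \<bullet> b) * ?D y b) = ?D y (V y)" if "y \<in> S" for y
    using linear_Basis_expansion[OF lin[OF that], of "V y"] by simp
  from has_derivative_transform_within_open[OF sum assms(1,2) this]
  have "((\<lambda>y. ?D y (V y)) has_derivative
      (\<lambda>w. \<Sum>b\<in>Basis. (V x \<bullet> b) * ?H b w + (?DV w \<bullet> b) * ?D x b)) (at x)" .
  then have "frechet_derivative (\<lambda>y. ?D y (V y)) (at x) w
      = (\<Sum>b\<in>Basis. (V x \<bullet> b) * ?H b w) + (\<Sum>b\<in>Basis. (?DV w \<bullet> b) * ?D x b)"
    by (simp add: frechet_derivative_at[symmetric] sum.distrib)
  also have "(\<Sum>b\<in>Basis. (?DV w \<bullet> b) * ?D x b) = ?D x (?DV w)"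
    using linear_Basis_expansion[OF lin[OF assms(2)], of "?DV w"] by simp
  also have "(\<Sum>b\<in>Basis. (V x \<bullet> b) * ?H b w) = (\<Sum>b\<in>Basis. (V x \<bullet> b) * ?H w b)"
    by (simp add: second_derivative_symmetric[OF assms(1,2,3), of _ w])
  also have "\<dots> = ?H w (V x)"
    using linear_Basis_expansion[OF has_derivative_linear[OF H[of w]], of "V x"] by simp
  finally show ?thesis by simp
qed

subsection \<open>A smooth bump function\<close>

text \<open>The classical flat function is \<open>flat_exp 0\<close>. The extra power of
  \<open>1 / t\<close> makes the linear span of the family closed under differentiation, so
  smoothness becomes an induction over all \<open>m\<close>.\<close>

definition flat_exp :: "nat \<Rightarrow> real \<Rightarrow> real" where
  "flat_exp m t = (if t > 0 then (1 / t) ^ m * exp (- (1 / t)) else 0)"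

lemma flat_exp_tendsto_0: "(flat_exp m \<longlongrightarrow> 0) (at 0)"
proof -
  have "((\<lambda>t::real. (1 / t) ^ m * exp (- (1 / t))) \<longlongrightarrow> 0) (at_right 0)"
  proof -
    have "((\<lambda>x::real. x ^ m / exp x) \<longlongrightarrow> 0) at_top"
      by (rule tendsto_power_div_exp_0)
    from filterlim_compose[OF this filterlim_inverse_at_top_right]
    show ?thesis by (simp add: exp_minus inverse_eq_divide)
  qed
  then have "(flat_exp m \<longlongrightarrow> 0) (at_right 0)"
    by (rule Lim_transform_eventually) (auto simp: flat_exp_def eventually_at_right_less intro: eventually_mono[OF eventually_at_right_less])
  moreover have "(flat_exp m \<longlongrightarrow> 0) (at_left 0)"
    by (rule tendsto_eventually) (auto simp: flat_exp_def eventually_at_filter)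
  ultimately show ?thesis by (simp add: filterlim_at_split)
qed

lemma flat_exp_has_derivative:
  "(flat_exp m has_real_derivative (- real m * flat_exp (Suc m) t + flat_exp (m + 2) t)) (at t)"
proof -
  consider "t > 0" | "t < 0" | "t = 0" by linarith
  then show ?thesis
  proof cases
    case 1
    have "((\<lambda>t. (1 / t) ^ m * exp (- (1 / t))) has_real_derivative
        (- real m * flat_exp (Suc m) t + flat_exp (m + 2) t)) (at t)"
    proof (cases m)
      case (Suc n)
      moreover have "n = 0 \<or> t ^ n = t * t ^ (n - Suc 0)" by (cases n) auto
      ultimately show ?thesis
        using 1 by (auto intro!: derivative_eq_intros simp: flat_exp_def field_simps power2_eq_square)
    qed (use 1 in \<open>auto intro!: derivative_eq_intros simp: flat_exp_def field_simps power2_eq_square\<close>)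
    then show ?thesis
      by (rule has_field_derivative_transform_within_open[of _ _ _ "{0<..}"]) (use 1 in \<open>auto simp: flat_exp_def\<close>)
  next
    case 2
    have "((\<lambda>t. 0) has_real_derivative (- real m * flat_exp (Suc m) t + flat_exp (m + 2) t)) (at t)"
      using 2 by (simp add: flat_exp_def)
    then show ?thesis
      by (rule has_field_derivative_transform_within_open[of _ _ _ "{..<0}"]) (use 2 in \<open>auto simp: flat_exp_def\<close>)
  next
    case 3
    \<comment> \<open>At 0 the difference quotient of \<open>flat_exp m\<close> is
      \<open>flat_exp (Suc m)\<close>, whose limit is 0.\<close>
    have "((\<lambda>h. flat_exp (Suc m) h) \<longlongrightarrow> 0) (at 0)" by (rule flat_exp_tendsto_0)
    moreover have "flat_exp (Suc m) h = (flat_exp m (0 + h) - flat_exp m 0) / h" for h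
      by (simp add: flat_exp_def)
    ultimately show ?thesis
      using 3 by (simp add: DERIV_def flat_exp_def)
  qed
qed

lemma smooth_on_flat_exp: "smooth_on UNIV (flat_exp m)"
proof -
  have "C_on k UNIV (flat_exp m)" for k
  proof (induction k arbitrary: m)
    case 0
    show ?case using flat_exp_has_derivative
      by (auto intro!: continuous_at_imp_continuous_on DERIV_isCont)
  next
    case (Suc k)
    show ?case
    proof (rule C_on_SucI)
      show "(flat_exp m has_derivative (*) (- real m * flat_exp (Suc m) t + flat_exp (m + 2) t)) (at t)" for t
        using flat_exp_has_derivative unfolding has_field_derivative_def .
      have "C_on k UNIV (\<lambda>t. (- real m * v) * flat_exp (Suc m) t + v * flat_exp (m + 2) t)" for v
        by (intro C_on_add C_on_bounded_linear[OF _ bounded_linear_mult_right] Suc.IH) auto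
      then show "C_on k UNIV (\<lambda>t. (- real m * flat_exp (Suc m) t + flat_exp (m + 2) t) * v)" for v
        by (rule C_on_cong[OF open_UNIV, rotated]) (simp add: algebra_simps)
    qed simp
  qed
  then show ?thesis by (simp add: smooth_on_def)
qed

lemma smooth_bump:
  fixes x :: "'e::euclidean_space"
  assumes "r > 0"
  obtains \<rho> :: "'e \<Rightarrow> real" where "smooth_on UNIV \<rho>" "\<rho> x = 1" "\<And>y. y \<notin> cball x r \<Longrightarrow> \<rho> y = 0"
proof
  \<comment> \<open>The square of the distance is used because, unlike the norm, it is smooth at the
    centre. \<open>?q\<close> is positive exactly inside the ball, and the factor
    \<open>inverse\<close> in \<open>\<rho>\<close> normalises the central value to 1.\<close>
  let ?q = "\<lambda>y::'e. r\<^sup>2 + - ((y + - x) \<bullet> (y + - x))"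
  define \<rho> where "\<rho> y = inverse (flat_exp 0 (r\<^sup>2)) * flat_exp 0 (?q y)" for y
  have lin: "smooth_on UNIV (\<lambda>y::'e. y + - x)"
    by (intro smooth_on_add smooth_on_const smooth_on_linear bounded_linear_ident) simp
  have "smooth_on UNIV (\<lambda>y::'e. (y + - x) \<bullet> (y + - x))"
    using lin C_on_bounded_bilinear[OF open_UNIV bounded_bilinear_inner] unfolding smooth_on_def by blast
  then have "smooth_on UNIV ?q"
    by (intro smooth_on_add smooth_on_const smooth_on_bounded_linear[OF _ bounded_linear_minus[OF bounded_linear_ident]]) auto
  then have "smooth_on UNIV (\<lambda>y. flat_exp 0 (?q y))"
    by (rule smooth_on_compose[OF _ _ _ _ smooth_on_flat_exp, rotated 3]) auto
  then show "smooth_on UNIV \<rho>"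
    unfolding \<rho>_def by (intro smooth_on_bounded_linear[OF _ bounded_linear_mult_right]) auto
  show "\<rho> x = 1" using assms by (simp add: \<rho>_def flat_exp_def)
  show "\<rho> y = 0" if "y \<notin> cball x r" for y
  proof -
    have "r \<le> norm (y - x)" using that by (simp add: dist_norm norm_minus_commute)
    then have "r\<^sup>2 \<le> (norm (y - x))\<^sup>2" using assms by (intro power_mono) auto
    then show ?thesis by (simp add: \<rho>_def flat_exp_def power2_norm_eq_inner)
  qed
qed

subsection \<open>Charts, functions and vector fields\<close>

abbreviation chart_inv :: "('a, 'e) chart \<Rightarrow> 'e \<Rightarrow> 'a" where
  "chart_inv c \<equiv> inv_into (fst c) (snd c)"

abbreviation chart_image :: "('a, 'e) chart \<Rightarrow> 'e set" where
  "chart_image c \<equiv> snd c ` fst c"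

definition chart_jacobian ::
  "('a, 'e::euclidean_space) chart \<Rightarrow> ('a, 'e) chart \<Rightarrow> 'a \<Rightarrow> 'e \<Rightarrow> 'e" where
  "chart_jacobian c d q = frechet_derivative (snd d \<circ> chart_inv c) (at (snd c q))"

lemma chart_components_jacobian:
  "chart_components A c q v = chart_jacobian (chart_at A q) c q v"
  by (simp add: chart_components_def chart_jacobian_def split_beta)

context smooth_manifold
begin

lemma chart_inv_apply: "c \<in> A \<Longrightarrow> q \<in> fst c \<Longrightarrow> chart_inv c (snd c q) = q"
  using homeomorphism_apply1[OF chart_homeomorphism] by (cases c) auto

lemma open_chart_domain: "c \<in> A \<Longrightarrow> open (fst c)"
  using chart_domain_open by (cases c) auto

lemma open_chart_image: "c \<in> A \<Longrightarrow> open (chart_image c)"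
  using chart_image_open by (cases c) auto

lemma open_chart_image_Int:
  assumes "c \<in> A" "open W"
  shows "open (snd c ` (fst c \<inter> W))"
proof -
  have h: "homeomorphism (fst c) (chart_image c) (snd c) (chart_inv c)"
    using chart_homeomorphism assms(1) by (cases c) auto
  have "openin (top_of_set (chart_image c)) (snd c ` (fst c \<inter> W))"
    by (rule homeomorphism_imp_open_map[OF h]) (use assms(2) in auto)
  then show ?thesis using openin_open_eq[OF open_chart_image[OF assms(1)]] by blast
qed

lemma chart_at:
  shows "chart_at A q \<in> A" and "q \<in> fst (chart_at A q)"
proof -
  obtain c where "c \<in> A \<and> q \<in> fst c" using charts_cover by (fastforce simp: split_beta set_eq_iff)
  then have "chart_at A q \<in> A \<and> q \<in> fst (chart_at A q)"
    unfolding chart_at_def by (rule someI)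
  then show "chart_at A q \<in> A" "q \<in> fst (chart_at A q)" by auto
qed

section \<open>Changes of chart\<close>

lemma transition_smooth': "c \<in> A \<Longrightarrow> d \<in> A \<Longrightarrow> smooth_on (snd c ` (fst c \<inter> fst d)) (snd d \<circ> chart_inv c)"
  using transition_smooth by (cases c; cases d) auto

lemma transition_differentiable:
  assumes "c \<in> A" "d \<in> A" "q \<in> fst c" "q \<in> fst d"
  shows "(snd d \<circ> chart_inv c) differentiable (at (snd c q))"
  by (rule smooth_on_differentiable[OF transition_smooth'[OF assms(1,2)]]) (use assms in auto)

lemma linear_chart_jacobian:
  assumes "c \<in> A" "d \<in> A" "q \<in> fst c" "q \<in> fst d"
  shows "linear (chart_jacobian c d q)"
  unfolding chart_jacobian_def
  by (rule linear_frechet_derivative[OF transition_differentiable[OF assms]])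

text \<open>The chain rule through the transition map; the two expressions of \<open>h\<close> agree
  only on the overlap, which is open. For a smooth function this gives chart independence of its
  derivative, and for a coordinate map the cocycle rule.\<close>

lemma frechet_derivative_change_chart:
  assumes "c \<in> A" "d \<in> A" "q \<in> fst c" "q \<in> fst d"
    and "(h \<circ> chart_inv d) differentiable (at (snd d q))"
  shows "frechet_derivative (h \<circ> chart_inv d) (at (snd d q)) (chart_jacobian c d q v)
       = frechet_derivative (h \<circ> chart_inv c) (at (snd c q)) v"
proof -
  let ?t = "snd d \<circ> chart_inv c"
  have tq: "?t (snd c q) = snd d q" by (simp add: chart_inv_apply assms)
  have t: "?t differentiable (at (snd c q))" by (rule transition_differentiable[OF assms(1-4)])
  have d: "(h \<circ> chart_inv d) differentiable (at (?t (snd c q)))" using assms(5) tq by simp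
  have "frechet_derivative ((h \<circ> chart_inv d) \<circ> ?t) (at (snd c q)) v
      = frechet_derivative (h \<circ> chart_inv d) (at (snd d q)) (chart_jacobian c d q v)"
    unfolding frechet_derivative_compose[OF t d] tq by (simp add: chart_jacobian_def)
  moreover have "frechet_derivative ((h \<circ> chart_inv d) \<circ> ?t) (at (snd c q))
      = frechet_derivative (h \<circ> chart_inv c) (at (snd c q))"
  proof (rule frechet_derivative_transform_within_open)
    show "((h \<circ> chart_inv d) \<circ> ?t) differentiable (at (snd c q))"
      by (rule differentiable_chain_at[OF t d])
    show "open (snd c ` (fst c \<inter> fst d))"
      by (rule open_chart_image_Int[OF assms(1) open_chart_domain[OF assms(2)]])
  qed (use assms in \<open>auto simp: chart_inv_apply\<close>)
  ultimately show ?thesis by simp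
qed

lemma chart_jacobian_cocycle:
  assumes "c \<in> A" "d \<in> A" "e \<in> A" "q \<in> fst c" "q \<in> fst d" "q \<in> fst e"
  shows "chart_jacobian d e q (chart_jacobian c d q v) = chart_jacobian c e q v"
  using frechet_derivative_change_chart[OF assms(1,2,4,5) transition_differentiable[OF assms(2,3,5,6)], of v]
  unfolding chart_jacobian_def[of d e] chart_jacobian_def[of c e] .

lemma chart_jacobian_self:
  assumes "c \<in> A" "q \<in> fst c"
  shows "chart_jacobian c c q v = v"
proof -
  have "((\<lambda>x. x) has_derivative (\<lambda>v. v)) (at (snd c q))" by (rule has_derivative_ident)
  then have "((snd c \<circ> chart_inv c) has_derivative (\<lambda>v. v)) (at (snd c q))"
    by (rule has_derivative_transform_within_open[OF _ open_chart_image[OF assms(1)]])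
      (use assms in \<open>auto simp: chart_inv_apply\<close>)
  then show ?thesis
    unfolding chart_jacobian_def using frechet_derivative_at by metis
qed

lemma chart_components_linear: "c \<in> A \<Longrightarrow> q \<in> fst c \<Longrightarrow> linear (chart_components A c q)"
  using linear_chart_jacobian chart_at unfolding chart_components_jacobian[abs_def] by blast

lemma chart_components_chart_at: "chart_components A (chart_at A q) q v = v"
  by (simp add: chart_components_jacobian chart_jacobian_self chart_at)

lemma coord_field_apply: "c \<in> A \<Longrightarrow> q \<in> fst c \<Longrightarrow> coord_field A c X (snd c q) = chart_components A c q (X q)"
  by (simp add: coord_field_def chart_inv_apply)

lemma smooth_functions_iff:
  "h \<in> smooth_functions A \<longleftrightarrow> (\<forall>c\<in>A. smooth_on (chart_image c) (h \<circ> chart_inv c))"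
  by (auto simp: smooth_functions_def)

lemma vector_fields_iff:
  "X \<in> vector_fields A \<longleftrightarrow> (\<forall>c\<in>A. smooth_on (chart_image c) (coord_field A c X))"
  by (auto simp: vector_fields_def)

lemma smooth_functions_differentiable:
  "h \<in> smooth_functions A \<Longrightarrow> c \<in> A \<Longrightarrow> q \<in> fst c \<Longrightarrow> (h \<circ> chart_inv c) differentiable (at (snd c q))"
  by (rule smooth_on_differentiable[of "chart_image c"]) (auto simp: smooth_functions_iff)

section \<open>Algebra of smooth functions and vector fields\<close>

lemma smooth_functions_const [simp]: "(\<lambda>q. a) \<in> smooth_functions A"
  by (simp add: smooth_functions_iff comp_def smooth_on_const)

lemma smooth_functions_add:
  "h \<in> smooth_functions A \<Longrightarrow> k \<in> smooth_functions A \<Longrightarrow> (\<lambda>q. h q + k q) \<in> smooth_functions A"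
  by (simp add: smooth_functions_iff comp_def smooth_on_add open_chart_image)

lemma smooth_functions_mult:
  "h \<in> smooth_functions A \<Longrightarrow> k \<in> smooth_functions A \<Longrightarrow> (\<lambda>q. h q * k q) \<in> smooth_functions A"
  by (simp add: smooth_functions_iff comp_def smooth_on_mult open_chart_image)

lemma vector_fields_add:
  assumes "X \<in> vector_fields A" "Y \<in> vector_fields A"
  shows "(\<lambda>q. X q + Y q) \<in> vector_fields A"
  unfolding vector_fields_iff
proof
  fix c assume c: "c \<in> A"
  have "smooth_on (chart_image c) (\<lambda>x. coord_field A c X x + coord_field A c Y x)"
    using assms c by (intro smooth_on_add open_chart_image) (auto simp: vector_fields_iff)
  then show "smooth_on (chart_image c) (coord_field A c (\<lambda>q. X q + Y q))"
    by (rule smooth_on_cong[OF open_chart_image[OF c], rotated])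
      (use c in \<open>auto simp: coord_field_apply linear_add[OF chart_components_linear]\<close>)
qed

lemma vector_fields_scaleR:
  assumes "h \<in> smooth_functions A" "X \<in> vector_fields A"
  shows "(\<lambda>q. h q *\<^sub>R X q) \<in> vector_fields A"
  unfolding vector_fields_iff
proof
  fix c assume c: "c \<in> A"
  have "smooth_on (chart_image c) (\<lambda>x. (h \<circ> chart_inv c) x *\<^sub>R coord_field A c X x)"
    using assms c by (intro smooth_on_scaleR open_chart_image) (auto simp: vector_fields_iff smooth_functions_iff simp del: comp_apply)
  then show "smooth_on (chart_image c) (coord_field A c (\<lambda>q. h q *\<^sub>R X q))"
    by (rule smooth_on_cong[OF open_chart_image[OF c], rotated])
      (use c in \<open>auto simp: coord_field_apply linear_scale[OF chart_components_linear] chart_inv_apply\<close>)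
qed

lemma vector_fields_zero [simp]: "(\<lambda>q. 0) \<in> vector_fields A"
  unfolding vector_fields_iff
proof
  fix c assume c: "c \<in> A"
  show "smooth_on (chart_image c) (coord_field A c (\<lambda>q. 0))"
    by (rule smooth_on_cong[OF open_chart_image[OF c] _ smooth_on_const[of _ 0]])
      (use c in \<open>auto simp: coord_field_apply linear_0[OF chart_components_linear]\<close>)
qed

lemma vector_fields_cmult: "X \<in> vector_fields A \<Longrightarrow> (\<lambda>q. a *\<^sub>R X q) \<in> vector_fields A"
  by (rule vector_fields_scaleR) simp

lemma vector_fields_minus: "X \<in> vector_fields A \<Longrightarrow> (\<lambda>q. - X q) \<in> vector_fields A"
  using vector_fields_cmult[of X "-1"] by simp

lemma vector_fields_diff:
  "X \<in> vector_fields A \<Longrightarrow> Y \<in> vector_fields A \<Longrightarrow> (\<lambda>q. X q - Y q) \<in> vector_fields A"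
  using vector_fields_add[OF _ vector_fields_minus, of X Y] by simp

lemma vector_fields_sum:
  "finite I \<Longrightarrow> (\<And>i. i \<in> I \<Longrightarrow> X i \<in> vector_fields A) \<Longrightarrow> (\<lambda>q. \<Sum>i\<in>I. X i q) \<in> vector_fields A"
  by (induction I rule: finite_induct) (auto intro: vector_fields_add)

text \<open>The definition uses a chart that varies with the point, so smoothness of the resulting
  function is visible only after passing to one fixed chart \<open>c\<close>.\<close>

lemma derivative_along_chart:
  assumes "h \<in> smooth_functions A" "c \<in> A" "q \<in> fst c"
  shows "derivative_along A X h q
       = frechet_derivative (h \<circ> chart_inv c) (at (snd c q)) (coord_field A c X (snd c q))"
  using frechet_derivative_change_chart[OF chart_at(1) assms(2) chart_at(2) assms(3)
      smooth_functions_differentiable[OF assms]]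
  by (simp add: coord_field_apply assms chart_components_jacobian derivative_along_def split_beta)

lemma derivative_along_smooth:
  assumes "X \<in> vector_fields A" "h \<in> smooth_functions A"
  shows "derivative_along A X h \<in> smooth_functions A"
  unfolding smooth_functions_iff
proof
  fix c assume c: "c \<in> A"
  have "smooth_on (chart_image c) (\<lambda>x. frechet_derivative (h \<circ> chart_inv c) (at x) (coord_field A c X x))"
    using assms c by (intro smooth_on_frechet_derivative_apply open_chart_image)
      (auto simp: vector_fields_iff smooth_functions_iff)
  then show "smooth_on (chart_image c) (derivative_along A X h \<circ> chart_inv c)"
    by (rule smooth_on_cong[OF open_chart_image[OF c], rotated])
      (use assms(2) c in \<open>auto simp: derivative_along_chart chart_inv_apply\<close>)
qed

text \<open>The constant map \<open>\<lambda>_. u\<close> need not be a smooth field; it only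
  inserts the tangent vector \<open>u\<close>, since \<open>derivative_along\<close> evaluates its
  field at a single point.\<close>

lemma derivative_along_has_derivative:
  assumes "h \<in> smooth_functions A"
  shows "((h \<circ> chart_inv (chart_at A q)) has_derivative (\<lambda>u. derivative_along A (\<lambda>_. u) h q))
    (at (snd (chart_at A q) q))"
  using smooth_functions_differentiable[OF assms chart_at]
  by (simp add: frechet_derivative_works derivative_along_def split_beta)

lemma derivative_along_at: "derivative_along A X h q = derivative_along A (\<lambda>_. X q) h q"
  by (simp add: derivative_along_def)

lemma derivative_along_linear:
  "h \<in> smooth_functions A \<Longrightarrow> linear (\<lambda>u. derivative_along A (\<lambda>_. u) h q)"
  using derivative_along_has_derivative has_derivative_linear by blast

lemma derivative_along_eqI:
  assumes "((h \<circ> chart_inv (chart_at A q)) has_derivative D) (at (snd (chart_at A q) q))"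
  shows "derivative_along A X h q = D (X q)"
  using frechet_derivative_at[OF assms] by (simp add: derivative_along_def split_beta)

lemma derivative_along_const [simp]: "derivative_along A X (\<lambda>q. a) p = 0"
  by (rule derivative_along_eqI) (simp add: comp_def)

lemma derivative_along_add:
  assumes "h \<in> smooth_functions A" "k \<in> smooth_functions A"
  shows "derivative_along A X (\<lambda>q. h q + k q) p = derivative_along A X h p + derivative_along A X k p"
proof -
  have "((\<lambda>q. h q + k q) \<circ> chart_inv (chart_at A p) has_derivative
      (\<lambda>u. derivative_along A (\<lambda>_. u) h p + derivative_along A (\<lambda>_. u) k p))
      (at (snd (chart_at A p) p))"
    using has_derivative_add[OF assms[THEN derivative_along_has_derivative], of p] by (simp add: comp_def)
  from derivative_along_eqI[OF this, of X] show ?thesis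
    by (simp only: derivative_along_at[of X])
qed

lemma derivative_along_mult:
  assumes "h \<in> smooth_functions A" "k \<in> smooth_functions A"
  shows "derivative_along A X (\<lambda>q. h q * k q) p
       = h p * derivative_along A X k p + derivative_along A X h p * k p"
proof -
  have "((\<lambda>q. h q * k q) \<circ> chart_inv (chart_at A p) has_derivative
      (\<lambda>u. h p * derivative_along A (\<lambda>_. u) k p + derivative_along A (\<lambda>_. u) h p * k p))
      (at (snd (chart_at A p) p))"
    using has_derivative_mult[OF assms[THEN derivative_along_has_derivative], of p]
    by (simp add: comp_def chart_inv_apply chart_at)
  from derivative_along_eqI[OF this, of X] show ?thesis
    by (simp only: derivative_along_at[of X])
qed

text \<open>Ties the coordinate bracket to the commutator of derivations: in one chart the
  second-order terms of the two compositions are equal by symmetry and cancel.\<close>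

lemma derivative_along_bracket:
  assumes X: "X \<in> vector_fields A" and Y: "Y \<in> vector_fields A" and h: "h \<in> smooth_functions A"
  shows "derivative_along A (lie_bracket A X Y) h p
       = derivative_along A X (derivative_along A Y h) p - derivative_along A Y (derivative_along A X h) p"
proof -
  define c where "c = chart_at A p"
  define x where "x = snd c p"
  define F where "F = h \<circ> chart_inv c"
  define X' where "X' = coord_field A c X"
  define Y' where "Y' = coord_field A c Y"
  have c: "c \<in> A" "p \<in> fst c" by (simp_all add: c_def chart_at)
  have S: "open (chart_image c)" "x \<in> chart_image c" using c open_chart_image by (auto simp: x_def)
  have sm: "smooth_on (chart_image c) F" "smooth_on (chart_image c) X'" "smooth_on (chart_image c) Y'"
    using assms c by (auto simp: F_def X'_def Y'_def smooth_functions_iff vector_fields_iff)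
  have x: "X' x = X p" "Y' x = Y p"
    using coord_field_apply[OF c] by (simp_all add: X'_def Y'_def x_def c_def chart_components_chart_at)
  have second: "derivative_along A Z (derivative_along A W h) p
      = frechet_derivative F (at x) (frechet_derivative (coord_field A c W) (at x) (Z p))
      + frechet_derivative (\<lambda>y. frechet_derivative F (at y) (Z p)) (at x) (coord_field A c W x)"
    if "W \<in> vector_fields A" for Z W
  proof -
    let ?G = "\<lambda>y. frechet_derivative F (at y) (coord_field A c W y)"
    have W: "smooth_on (chart_image c) (coord_field A c W)" using that c by (simp add: vector_fields_iff)
    \<comment> \<open>The inner derivative is a function on the manifold defined through varying
      charts; before differentiating it again it is rewritten in the single chart
      \<open>c\<close>.\<close>
    have "frechet_derivative (derivative_along A W h \<circ> chart_inv c) (at x) = frechet_derivative ?G (at x)"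
    proof (rule frechet_derivative_transform_within_open[OF _ S])
      show "(derivative_along A W h \<circ> chart_inv c) differentiable (at x)"
        unfolding x_def by (rule smooth_functions_differentiable[OF derivative_along_smooth[OF that h] c])
    qed (use h c in \<open>auto simp: derivative_along_chart chart_inv_apply F_def\<close>)
    moreover have "derivative_along A Z (derivative_along A W h) p
        = frechet_derivative (derivative_along A W h \<circ> chart_inv c) (at x) (Z p)"
      by (simp add: derivative_along_def[of _ Z] c_def x_def split_beta)
    ultimately show ?thesis
      using frechet_derivative_apply_field[OF S sm(1) W] by simp
  qed
  have lin: "linear (frechet_derivative F (at x))"
    using smooth_on_frechet_derivative(1)[OF sm(1) S(2)] has_derivative_linear by blast
  have "derivative_along A (lie_bracket A X Y) h p
      = frechet_derivative F (at x) (frechet_derivative Y' (at x) (X' x) - frechet_derivative X' (at x) (Y' x))"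
    by (simp add: derivative_along_def lie_bracket_def Let_def split_beta F_def x_def X'_def Y'_def c_def)
  then show ?thesis
    using second_derivative_symmetric[OF S sm(1), of "X p" "Y p"]
    by (simp add: second[OF X] second[OF Y] linear_diff[OF lin] X'_def[symmetric] Y'_def[symmetric] x)
qed

lemma lie_bracket_swap: "lie_bracket A X Y p = - lie_bracket A Y X p"
  by (simp add: lie_bracket_def Let_def)

subsection \<open>Bump functions and local frames\<close>

text \<open>That \<open>K\<close> is closed in the whole manifold, not just in the chart domain, uses the Hausdorff property; it makes
  extensions by zero smooth.\<close>

lemma chart_bump:
  assumes "c \<in> A" "p \<in> fst c"
  obtains \<rho> :: "'e \<Rightarrow> real" and K where "smooth_on UNIV \<rho>" "\<rho> (snd c p) = 1" "closed K"
    "\<forall>q\<in>fst c - K. \<rho> (snd c q) = 0" "K \<subseteq> fst c"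
proof -
  obtain r where r: "r > 0" "cball (snd c p) r \<subseteq> chart_image c"
    using open_contains_cball_eq[OF open_chart_image[OF assms(1)]] assms by blast
  obtain \<rho> :: "'e \<Rightarrow> real" where \<rho>: "smooth_on UNIV \<rho>" "\<rho> (snd c p) = 1"
    "\<And>y. y \<notin> cball (snd c p) r \<Longrightarrow> \<rho> y = 0"
    using smooth_bump[OF r(1)] by blast
  define K where "K = chart_inv c ` cball (snd c p) r"
  have "continuous_on (chart_image c) (chart_inv c)"
    using homeomorphism_cont2[OF chart_homeomorphism] assms(1) by (cases c) auto
  then have "compact K"
    unfolding K_def by (intro compact_continuous_image compact_cball continuous_on_subset[OF _ r(2)])
  then have "closed K" by (rule compact_imp_closed)
  moreover have "\<rho> (snd c q) = 0" if "q \<in> fst c" "q \<notin> K" for q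
  proof (rule \<rho>(3))
    show "snd c q \<notin> cball (snd c p) r"
      using that chart_inv_apply[OF assms(1) that(1)] unfolding K_def by (metis imageI)
  qed
  moreover have "K \<subseteq> fst c" unfolding K_def using r(2) inv_into_into[of _ "snd c" "fst c"] by blast
  ultimately show thesis using that[OF \<rho>(1,2)] by blast
qed

text \<open>The image of \<open>d\<close> is covered by two open pieces: the overlap with
  \<open>c\<close>, and the complement of \<open>K\<close>, where \<open>G\<close> vanishes.\<close>

lemma smooth_on_zero_extension:
  assumes "c \<in> A" "d \<in> A" "closed K" "K \<subseteq> fst c"
    and "smooth_on (snd d ` (fst d \<inter> fst c)) G"
    and "\<And>q. q \<in> fst d \<Longrightarrow> q \<notin> K \<Longrightarrow> G (snd d q) = 0"
  shows "smooth_on (chart_image d) G"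
proof -
  have op: "open (snd d ` (fst d \<inter> fst c))" "open (snd d ` (fst d \<inter> - K))"
    using assms by (auto intro!: open_chart_image_Int open_chart_domain)
  have "smooth_on (snd d ` (fst d \<inter> - K)) G"
    by (rule smooth_on_cong[OF op(2) _ smooth_on_const[of _ 0]]) (use assms(6) in auto)
  then have "smooth_on (snd d ` (fst d \<inter> fst c) \<union> snd d ` (fst d \<inter> - K)) G"
    using smooth_on_Un[OF op] assms(5) by blast
  moreover have "snd d ` (fst d \<inter> fst c) \<union> snd d ` (fst d \<inter> - K) = chart_image d"
    using assms(4) by blast
  ultimately show ?thesis by simp
qed

lemma bump_function_smooth:
  fixes F :: "'e \<Rightarrow> real"
  assumes "c \<in> A" "closed K" "K \<subseteq> fst c" "smooth_on UNIV \<rho>"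
    and "\<forall>q\<in>fst c - K. \<rho> (snd c q) = 0"
    and "smooth_on (chart_image c) F"
  shows "(\<lambda>q. if q \<in> fst c then \<rho> (snd c q) * F (snd c q) else 0) \<in> smooth_functions A"
  unfolding smooth_functions_iff
proof
  fix d assume d: "d \<in> A"
  let ?h = "\<lambda>q. if q \<in> fst c then \<rho> (snd c q) * F (snd c q) else 0"
  let ?S = "snd d ` (fst d \<inter> fst c)"
  have S: "open ?S" using open_chart_image_Int[OF d open_chart_domain[OF assms(1)]] .
  have "smooth_on (chart_image c) (\<lambda>x. \<rho> x * F x)"
    by (rule smooth_on_mult[OF open_chart_image[OF assms(1)] smooth_on_subset[OF assms(4)] assms(6)]) simp
  moreover have "(snd c \<circ> chart_inv d) ` ?S \<subseteq> chart_image c" using d by (auto simp: chart_inv_apply)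
  ultimately
  have "smooth_on ?S (\<lambda>x. (\<lambda>x. \<rho> x * F x) ((snd c \<circ> chart_inv d) x))"
    using smooth_on_compose[OF S open_chart_image[OF assms(1)] _ transition_smooth'[OF d assms(1)]] by blast
  then have "smooth_on ?S (?h \<circ> chart_inv d)"
    by (rule smooth_on_cong[OF S, rotated]) (use d in \<open>auto simp: chart_inv_apply\<close>)
  then show "smooth_on (chart_image d) (?h \<circ> chart_inv d)"
    by (rule smooth_on_zero_extension[OF assms(1) d assms(2,3)])
      (use d assms(5) in \<open>auto simp: chart_inv_apply\<close>)
qed

text \<open>The coordinate field \<open>b\<close> of chart \<open>c\<close>, cut off. The Jacobian
  converts it to the components chosen at \<open>q\<close>, and by the cocycle rule its expression
  in \<open>d\<close> is the derivative of the transition map, independently of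
  \<open>chart_at\<close>.\<close>

lemma bump_field_smooth:
  assumes "c \<in> A" "closed K" "K \<subseteq> fst c" "smooth_on UNIV \<rho>"
    and "\<forall>q\<in>fst c - K. \<rho> (snd c q) = 0"
  shows "(\<lambda>q. if q \<in> fst c then \<rho> (snd c q) *\<^sub>R chart_jacobian c (chart_at A q) q b else 0) \<in> vector_fields A"
  unfolding vector_fields_iff
proof
  fix d assume d: "d \<in> A"
  let ?E = "\<lambda>q. if q \<in> fst c then \<rho> (snd c q) *\<^sub>R chart_jacobian c (chart_at A q) q b else 0"
  let ?S = "snd d ` (fst d \<inter> fst c)" and ?T = "snd c ` (fst c \<inter> fst d)"
  have S: "open ?S" and T: "open ?T"
    using open_chart_image_Int open_chart_domain d assms(1) by blast+
  have "smooth_on ?T (\<lambda>x. \<rho> x *\<^sub>R frechet_derivative (snd d \<circ> chart_inv c) (at x) b)"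
    by (intro smooth_on_scaleR T smooth_on_subset[OF assms(4)] smooth_on_frechet_derivative(2)
        transition_smooth' assms(1) d) simp
  moreover have "(snd c \<circ> chart_inv d) ` ?S \<subseteq> ?T" using d by (auto simp: chart_inv_apply)
  ultimately
  have "smooth_on ?S (\<lambda>x. (\<lambda>x. \<rho> x *\<^sub>R frechet_derivative (snd d \<circ> chart_inv c) (at x) b)
      ((snd c \<circ> chart_inv d) x))"
    using smooth_on_compose[OF S T _ transition_smooth'[OF d assms(1)]] by blast
  then have "smooth_on ?S (coord_field A d ?E)"
    by (rule smooth_on_cong[OF S, rotated])
      (use d assms(1) in \<open>auto simp: chart_inv_apply coord_field_apply linear_scale[OF linear_chart_jacobian]
        chart_components_jacobian chart_jacobian_cocycle chart_at chart_jacobian_def[of c d]\<close>)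
  then show "smooth_on (chart_image d) (coord_field A d ?E)"
    by (rule smooth_on_zero_extension[OF assms(1) d assms(2,3)])
      (use d assms(5) in \<open>auto simp: coord_field_apply linear_0[OF chart_components_linear]\<close>)
qed

text \<open>The squared bump function lets both the coefficients and the frame fields be globally smooth.\<close>

lemma local_frame:
  obtains \<rho> E z where "\<rho> \<in> smooth_functions A" "\<rho> p = 1"
    "\<forall>b. E b \<in> vector_fields A \<and> E b p = b"
    "\<forall>Z\<in>vector_fields A. \<forall>b. z Z b \<in> smooth_functions A" "\<forall>Z b. z Z b p = Z p \<bullet> b"
    "\<forall>Z q. (\<rho> q * \<rho> q) *\<^sub>R Z q = (\<Sum>b\<in>Basis. z Z b q *\<^sub>R E b q)"
proof -
  define c where "c = chart_at A p"
  have c: "c \<in> A" "p \<in> fst c" by (simp_all add: c_def chart_at)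
  obtain \<rho> :: "'e \<Rightarrow> real" and K where \<rho>: "smooth_on UNIV \<rho>" "\<rho> (snd c p) = 1" and K: "closed K"
    "\<forall>q\<in>fst c - K. \<rho> (snd c q) = 0" "K \<subseteq> fst c"
    by (rule chart_bump[OF c]) (rule that)
  \<comment> \<open>The factor 1 makes \<open>r\<close> an instance of
    \<open>bump_function_smooth\<close>.\<close>
  define r where "r q = (if q \<in> fst c then \<rho> (snd c q) * 1 else 0)" for q
  define E where "E b q = (if q \<in> fst c then \<rho> (snd c q) *\<^sub>R chart_jacobian c (chart_at A q) q b else 0)" for b q
  define z where "z Z b q = (if q \<in> fst c then \<rho> (snd c q) * (coord_field A c Z (snd c q) \<bullet> b) else 0)" for Z b q
  have r: "r \<in> smooth_functions A"
    unfolding r_def by (rule bump_function_smooth[OF c(1) K(1,3) \<rho>(1) K(2) smooth_on_const])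
  have r1: "r p = 1" using c \<rho>(2) by (simp add: r_def)
  have E: "E b \<in> vector_fields A" "E b p = b" for b
    unfolding E_def by (rule bump_field_smooth[OF c(1) K(1,3) \<rho>(1) K(2)])
      (use c \<rho>(2) in \<open>simp add: c_def[symmetric] chart_jacobian_self\<close>)
  have z: "z Z b \<in> smooth_functions A" if "Z \<in> vector_fields A" for Z b
    unfolding z_def
    by (rule bump_function_smooth[OF c(1) K(1,3) \<rho>(1) K(2)])
      (use that c in \<open>auto intro!: smooth_on_bounded_linear[OF _ bounded_linear_inner_left] open_chart_image
        simp: vector_fields_iff\<close>)
  have zp: "z Z b p = Z p \<bullet> b" for Z b
    using c \<rho>(2) by (simp add: z_def coord_field_apply chart_components_chart_at[of p, folded c_def])
  have "(r q * r q) *\<^sub>R Z q = (\<Sum>b\<in>Basis. z Z b q *\<^sub>R E b q)" for Z q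
  proof (cases "q \<in> fst c")
    case True
    let ?J = "chart_jacobian c (chart_at A q) q" and ?u = "coord_field A c Z (snd c q)"
    have "?J ?u = (\<Sum>b\<in>Basis. (?u \<bullet> b) *\<^sub>R ?J b)"
      by (rule linear_Basis_expansion[OF linear_chart_jacobian]) (simp_all add: c True chart_at)
    moreover have "?J ?u = Z q"
      using c True by (simp add: coord_field_apply chart_components_jacobian chart_jacobian_cocycle
          chart_at chart_jacobian_self)
    ultimately have "Z q = (\<Sum>b\<in>Basis. (?u \<bullet> b) *\<^sub>R ?J b)" by simp
    then have "(r q * r q) *\<^sub>R Z q = (r q * r q) *\<^sub>R (\<Sum>b\<in>Basis. (?u \<bullet> b) *\<^sub>R ?J b)" by (rule arg_cong)
    also have "\<dots> = (\<Sum>b\<in>Basis. z Z b q *\<^sub>R E b q)"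
      unfolding scaleR_sum_right using True by (intro sum.cong) (auto simp: r_def E_def z_def)
    finally show ?thesis .
  qed (simp add: r_def z_def)
  then show thesis using r r1 E z zp by (intro that[of r E z]) simp_all
qed

lemma vector_field_through: obtains X where "X \<in> vector_fields A" "X p = u"
  by (rule local_frame[of p]) (use that in blast)

text \<open>Linearity over smooth functions localises. Applying \<open>T\<close> to the global
  identity that writes \<open>\<rho>\<close> squared times \<open>Z\<close> as a combination of the
  fields \<open>E b\<close> leaves, at \<open>p\<close>, a sum that involves \<open>Z\<close> only
  through \<open>Z p\<close>.\<close>

lemma tensorial:
  fixes T :: "('a \<Rightarrow> 'e) \<Rightarrow> 'b::real_vector"
  assumes add: "\<And>X Y. X \<in> vector_fields A \<Longrightarrow> Y \<in> vector_fields A \<Longrightarrow> T (\<lambda>q. X q + Y q) = T X + T Y"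
    and scale: "\<And>h X. h \<in> smooth_functions A \<Longrightarrow> X \<in> vector_fields A \<Longrightarrow> T (\<lambda>q. h q *\<^sub>R X q) = h p *\<^sub>R T X"
    and "X \<in> vector_fields A" "Y \<in> vector_fields A" "X p = Y p"
  shows "T X = T Y"
proof -
  obtain \<rho> E z where \<rho>: "\<rho> \<in> smooth_functions A" "\<rho> p = 1"
    and "\<forall>b. E b \<in> vector_fields A \<and> E b p = b"
    and "\<forall>Z\<in>vector_fields A. \<forall>b. z Z b \<in> smooth_functions A" "\<forall>Z b. z Z b p = Z p \<bullet> b"
    and "\<forall>Z q. (\<rho> q * \<rho> q) *\<^sub>R Z q = (\<Sum>b\<in>Basis. z Z b q *\<^sub>R E b q)"
    by (rule local_frame[of p]) (rule that)
  then have E: "\<And>b. E b \<in> vector_fields A"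
    and z: "\<And>Z b. Z \<in> vector_fields A \<Longrightarrow> z Z b \<in> smooth_functions A" "\<And>Z b. z Z b p = Z p \<bullet> b"
    and eq: "\<And>Z q. (\<rho> q * \<rho> q) *\<^sub>R Z q = (\<Sum>b\<in>Basis. z Z b q *\<^sub>R E b q)"
    by blast+
  have zero: "T (\<lambda>q. 0) = 0" using scale[of "\<lambda>q. 0" "\<lambda>q. 0"] by simp
  have sum: "T (\<lambda>q. \<Sum>b\<in>I. z Z b q *\<^sub>R E b q) = (\<Sum>b\<in>I. (Z p \<bullet> b) *\<^sub>R T (E b))"
    if "finite I" "Z \<in> vector_fields A" for I Z
    using that(1)
  proof (induction I rule: finite_induct)
    case (insert b I)
    have "T (\<lambda>q. z Z b q *\<^sub>R E b q + (\<Sum>b\<in>I. z Z b q *\<^sub>R E b q))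
        = T (\<lambda>q. z Z b q *\<^sub>R E b q) + T (\<lambda>q. \<Sum>b\<in>I. z Z b q *\<^sub>R E b q)"
      by (intro add vector_fields_scaleR vector_fields_sum insert z E that(2))
    then show ?case using insert scale[OF z(1)[OF that(2)] E] by (simp add: z(2))
  qed (simp add: zero)
  have "T Z = (\<Sum>b\<in>Basis. (Z p \<bullet> b) *\<^sub>R T (E b))" if "Z \<in> vector_fields A" for Z
    using scale[OF smooth_functions_mult[OF \<rho>(1) \<rho>(1)] that] sum[OF finite_Basis that] by (simp add: eq \<rho>(2))
  then show ?thesis using assms(3-5) by simp
qed

text \<open>Lets vector identities such as Jacobi's be checked on global functions.\<close>

lemma tangent_vector_zeroI:
  assumes "\<And>h. h \<in> smooth_functions A \<Longrightarrow> derivative_along A (\<lambda>_. u) h p = 0"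
  shows "u = 0"
proof (rule euclidean_eqI)
  fix b :: 'e
  define c where "c = chart_at A p"
  have c: "c \<in> A" "p \<in> fst c" by (simp_all add: c_def chart_at)
  obtain \<rho> :: "'e \<Rightarrow> real" and K where \<rho>: "smooth_on UNIV \<rho>" "\<rho> (snd c p) = 1" and K: "closed K"
    "\<forall>q\<in>fst c - K. \<rho> (snd c q) = 0" "K \<subseteq> fst c"
    by (rule chart_bump[OF c]) (rule that)
  \<comment> \<open>The coordinate is shifted to vanish at \<open>p\<close>, so that the derivative
    of \<open>\<rho>\<close> drops out of the product rule.\<close>
  let ?F = "\<lambda>x. (x + - snd c p) \<bullet> b"
  let ?h = "\<lambda>q. if q \<in> fst c then \<rho> (snd c q) * ?F (snd c q) else 0"
  have F: "smooth_on (chart_image c) ?F"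
    by (intro smooth_on_bounded_linear[OF _ bounded_linear_inner_left] smooth_on_add smooth_on_const
        smooth_on_linear bounded_linear_ident open_chart_image c)
  have h: "?h \<in> smooth_functions A"
    by (rule bump_function_smooth[OF c(1) K(1,3) \<rho>(1) K(2) F])
  have "(\<rho> has_derivative frechet_derivative \<rho> (at (snd c p))) (at (snd c p))"
    using smooth_on_frechet_derivative(1)[OF \<rho>(1)] by simp
  moreover have "(?F has_derivative (\<lambda>v. v \<bullet> b)) (at (snd c p))"
    by (auto intro!: derivative_eq_intros)
  ultimately have "((\<lambda>x. \<rho> x * ?F x) has_derivative (\<lambda>v. v \<bullet> b)) (at (snd c p))"
    using has_derivative_mult[of \<rho> _ "snd c p" UNIV ?F "\<lambda>v. v \<bullet> b"] \<rho>(2) by simp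
  then have "((?h \<circ> chart_inv c) has_derivative (\<lambda>v. v \<bullet> b)) (at (snd c p))"
    by (rule has_derivative_transform_within_open[OF _ open_chart_image[OF c(1)]])
      (use c in \<open>auto simp: chart_inv_apply\<close>)
  from derivative_along_eqI[OF this[unfolded c_def], of "\<lambda>_. u"] assms[OF h, unfolded c_def]
  show "u \<bullet> b = 0 \<bullet> b" by (simp only: inner_zero_left)
qed

end

subsection \<open>Algebraic curvature tensors\<close>

text \<open>Isolated from geometry because it is instantiated twice: by the curvature at a point,
  and by its difference from the tensor of constant curvature \<open>c\<close>.\<close>

locale algebraic_curvature =
  fixes F :: "'v::real_vector \<Rightarrow> 'v \<Rightarrow> 'v \<Rightarrow> 'v \<Rightarrow> real"
  assumes skew12: "F u v w x = - F v u w x"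
    and skew34: "F u v w x = - F u v x w"
    and bianchi: "F u v w x + F v w u x + F w u v x = 0"
begin

text \<open>Of the four cyclic shifts of the Bianchi identity, add the first two and subtract the
  last two: by skew-symmetry all cancels except twice the difference of the two sides.\<close>

lemma pair_symmetric: "F u v w x = F w x u v"
  using bianchi[of u v w x] bianchi[of v w x u] bianchi[of w x u v] bianchi[of x u v w]
    skew34[of u v w x] skew34[of v w u x] skew34[of w x u v] skew34[of x u v w]
    skew12[of u w x v] skew34[of w u x v] skew12[of v x u w] skew34[of x v u w]
  by linarith

text \<open>Polarising in the middle pair and then in the outer pair makes \<open>F\<close> skew in
  its first and last arguments, hence invariant under cyclic permutation of the first three; Bianchi
  then says that three times \<open>F\<close> is 0. Sums are all that polarisation asks of
  \<open>S\<close>.\<close>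

lemma zero_of_sectional_zero:
  assumes add: "\<And>u u' v w x. F (u + u') v w x = F u v w x + F u' v w x"
    and S: "\<And>u v. u \<in> S \<Longrightarrow> v \<in> S \<Longrightarrow> u + v \<in> S"
    and zero: "\<And>u v. u \<in> S \<Longrightarrow> v \<in> S \<Longrightarrow> F u v v u = 0"
    and "u \<in> S" "v \<in> S" "w \<in> S" "x \<in> S"
  shows "F u v w x = 0"
proof -
  have add3: "F a b (c + c') d = F a b c d + F a b c' d" for a b c c' d
    using add[of c c' d a b] by (metis pair_symmetric)
  have add2: "F a (b + b') c d = F a b c d + F a b' c d" for a b b' c d
    using add[of b b' a c d] skew12[of a "b + b'" c d] skew12[of a b c d] skew12[of a b' c d] by simp
  have add4: "F a b c (d + d') = F a b c d + F a b c d'" for a b c d d'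
    using add3[of a b d d' c] skew34[of a b c "d + d'"] skew34[of a b c d] skew34[of a b c d'] by simp
  have middle: "F a b c a = 0" if "a \<in> S" "b \<in> S" "c \<in> S" for a b c
  proof -
    have "F a (b + c) (b + c) a = 0" "F a b b a = 0" "F a c c a = 0"
      using that S zero by simp_all
    moreover have "F a c b a = F a b c a"
      using pair_symmetric[of a c b a] skew12[of b a a c] skew34[of a b a c] by simp
    ultimately show ?thesis by (simp add: add2 add3)
  qed
  have outer: "F a b c d = - F d b c a" if "a \<in> S" "b \<in> S" "c \<in> S" "d \<in> S" for a b c d
    using middle[of "a + d" b c] middle[of a b c] middle[of d b c] that S by (simp add: add add4)
  have cycle: "F a b c d = F c a b d" if "a \<in> S" "b \<in> S" "c \<in> S" "d \<in> S" for a b c d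
    using outer[OF that] skew12[of d b c a] pair_symmetric[of b d c a] by simp
  show ?thesis
    using bianchi[of u v w x] cycle[of u v w x] cycle[of w u v x] assms by simp
qed

end

subsection \<open>The Levi-Civita connection and its curvature\<close>

locale levi_civita_manifold = riemannian_manifold A g
  for A :: "('a::{t2_space, second_countable_topology}, 'e::euclidean_space) chart set"
    and g :: "'a \<Rightarrow> 'e \<Rightarrow> 'e \<Rightarrow> real" +
  fixes nabla :: "('a, 'e) connection"
  assumes levi_civita: "levi_civita_connection A g nabla"
begin

abbreviation "VF \<equiv> vector_fields A"
abbreviation "SF \<equiv> smooth_functions A"
abbreviation "bracket \<equiv> lie_bracket A"
abbreviation "deriv_along \<equiv> derivative_along A"

section \<open>Linear algebra of the metric at a point\<close>

lemma metric_linear_right: "linear (g p u)"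
  using metric_bilinear by (simp add: bilinear_def)

lemma metric_linear_left: "linear (\<lambda>u. g p u v)"
  using metric_bilinear by (simp add: bilinear_def)

lemmas metric_simps =
  linear_add[OF metric_linear_right] linear_add[OF metric_linear_left]
  linear_diff[OF metric_linear_right] linear_diff[OF metric_linear_left]
  linear_neg[OF metric_linear_right] linear_neg[OF metric_linear_left]
  linear_scale[OF metric_linear_right, unfolded real_scaleR_def]
  linear_scale[OF metric_linear_left, unfolded real_scaleR_def]
  linear_0[OF metric_linear_right] linear_0[OF metric_linear_left]
  linear_sum[OF metric_linear_right] linear_sum[OF metric_linear_left]

lemma metric_eqI:
  assumes "\<And>w. g p u w = g p v w"
  shows "u = v"
proof (rule ccontr)
  assume "u \<noteq> v"
  then have "g p (u - v) (u - v) > 0" by (intro metric_pos) simp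
  then show False using assms[of "u - v"] by (simp add: metric_simps)
qed

text \<open>The frame is orthonormal for \<open>g p\<close>, not for the inner product of the type
  \<open>'e\<close>. It is independent and has \<open>DIM('e)\<close> elements, so it spans, and the
  coefficients of \<open>u\<close> are its products with the frame.\<close>

lemma parseval:
  assumes "orthonormal_frame_at g p e"
  shows "(\<Sum>i=1..DIM('e). g p u (e i) * g p v (e i)) = g p u v"
proof -
  let ?I = "{1..DIM('e)}"
  have e: "g p (e i) (e j) = (if i = j then 1 else 0)" if "i \<in> ?I" "j \<in> ?I" for i j
    using assms that by (auto simp: orthonormal_frame_at_def)
  have inj: "inj_on e ?I"
    by (rule inj_onI) (metis e zero_neq_one)
  have coeff: "g p (\<Sum>i\<in>?I. c i *\<^sub>R e i) (e j) = c j" if "j \<in> ?I" for c j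
  proof -
    have "g p (\<Sum>i\<in>?I. c i *\<^sub>R e i) (e j) = (\<Sum>i\<in>?I. if i = j then c i else 0)"
      unfolding linear_sum[OF metric_linear_left] using that e by (intro sum.cong) (auto simp: metric_simps)
    also have "\<dots> = c j" using that by (simp only: sum.delta finite_atLeastAtMost if_True)
    finally show ?thesis .
  qed
  have reindex: "(\<Sum>v\<in>e ` ?I. c v *\<^sub>R v) = (\<Sum>i\<in>?I. c (e i) *\<^sub>R e i)" for c :: "'e \<Rightarrow> real"
    using sum.reindex[OF inj] by (simp add: comp_def)
  have "independent (e ` ?I)"
  proof (rule independent_if_scalars_zero)
    fix c :: "'e \<Rightarrow> real" and w
    assume "(\<Sum>v\<in>e ` ?I. c v *\<^sub>R v) = 0" "w \<in> e ` ?I"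
    then show "c w = 0" using coeff[of _ "\<lambda>i. c (e i)"] unfolding reindex by (auto simp: metric_simps)
  qed simp
  moreover have "card (e ` ?I) = DIM('e)" using card_image[OF inj] by simp
  ultimately have "UNIV \<subseteq> span (e ` ?I)"
    by (intro card_ge_dim_independent) auto
  then have "u \<in> span (e ` ?I)" by blast
  then obtain c where "u = (\<Sum>v\<in>e ` ?I. c v *\<^sub>R v)"
    unfolding span_finite[OF finite_imageI[OF finite_atLeastAtMost]] by blast
  then have u: "u = (\<Sum>i\<in>?I. c (e i) *\<^sub>R e i)" unfolding reindex .
  have "g p u v = (\<Sum>i\<in>?I. c (e i) * g p (e i) v)"
    by (subst u) (simp only: metric_simps)
  also have "\<dots> = (\<Sum>i\<in>?I. g p u (e i) * g p v (e i))"
    by (intro sum.cong refl) (use coeff[of _ "\<lambda>i. c (e i)"] u metric_sym[of p v] in simp)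
  finally show ?thesis ..
qed

lemma exists_unit_orthogonal:
  assumes "finite W" "card W < DIM('e)"
  obtains v where "g p v v = 1" "\<forall>w\<in>W. g p v w = 0"
proof -
  \<comment> \<open>\<open>G w\<close> represents the functional \<open>\<lambda>v. g p v w\<close>
    in the inner product of the type, which turns \<open>g p\<close>-orthogonality into
    \<open>orthogonal\<close>.\<close>
  define G where "G w = (\<Sum>b\<in>Basis. g p b w *\<^sub>R b)" for w
  have G: "v \<bullet> G w = g p v w" for v w
    using linear_Basis_expansion[OF metric_linear_left[of p w], of v]
    by (simp add: G_def inner_sum_right mult.commute)
  have "dim (G ` W) < DIM('e)"
    using dim_le_card'[of "G ` W"] card_image_le[OF assms(1), of G] assms by simp
  then obtain v where v: "v \<noteq> 0" "\<And>y. y \<in> span (G ` W) \<Longrightarrow> orthogonal v y"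
    using orthogonal_to_subspace_exists by blast
  have pos: "g p v v > 0" using metric_pos[OF v(1)] .
  show thesis
  proof
    show "g p ((1 / sqrt (g p v v)) *\<^sub>R v) ((1 / sqrt (g p v v)) *\<^sub>R v) = 1"
      using pos by (simp add: metric_simps)
    have "g p v w = 0" if "w \<in> W" for w
      using v(2)[of "G w"] that G by (simp add: span_base orthogonal_def)
    then show "\<forall>w\<in>W. g p ((1 / sqrt (g p v v)) *\<^sub>R v) w = 0"
      by (simp add: metric_simps)
  qed
qed

section \<open>Rules for the connection and the bracket\<close>

lemma nabla_affine: "affine_connection A nabla"
  using levi_civita by (simp add: levi_civita_connection_def)

lemma nabla_field: "X \<in> VF \<Longrightarrow> Y \<in> VF \<Longrightarrow> nabla X Y \<in> VF"
  using nabla_affine by (simp add: affine_connection_def)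

lemma nabla_add_left:
  "X \<in> VF \<Longrightarrow> Y \<in> VF \<Longrightarrow> Z \<in> VF \<Longrightarrow> nabla (\<lambda>q. X q + Y q) Z = (\<lambda>q. nabla X Z q + nabla Y Z q)"
  using nabla_affine by (simp add: affine_connection_def)

lemma nabla_add_right:
  "X \<in> VF \<Longrightarrow> Y \<in> VF \<Longrightarrow> Z \<in> VF \<Longrightarrow> nabla X (\<lambda>q. Y q + Z q) = (\<lambda>q. nabla X Y q + nabla X Z q)"
  using nabla_affine by (simp add: affine_connection_def)

lemma nabla_scaleR_left:
  "h \<in> SF \<Longrightarrow> X \<in> VF \<Longrightarrow> Y \<in> VF \<Longrightarrow> nabla (\<lambda>q. h q *\<^sub>R X q) Y = (\<lambda>q. h q *\<^sub>R nabla X Y q)"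
  using nabla_affine by (simp add: affine_connection_def)

lemma nabla_scaleR_right:
  "h \<in> SF \<Longrightarrow> X \<in> VF \<Longrightarrow> Y \<in> VF \<Longrightarrow>
    nabla X (\<lambda>q. h q *\<^sub>R Y q) = (\<lambda>q. h q *\<^sub>R nabla X Y q + deriv_along X h q *\<^sub>R Y q)"
  using nabla_affine by (simp add: affine_connection_def)

lemma nabla_minus_left: "X \<in> VF \<Longrightarrow> Y \<in> VF \<Longrightarrow> nabla (\<lambda>q. - X q) Y = (\<lambda>q. - nabla X Y q)"
  using nabla_scaleR_left[of "\<lambda>q. -1" X Y] by simp

lemma nabla_minus_right: "X \<in> VF \<Longrightarrow> Y \<in> VF \<Longrightarrow> nabla X (\<lambda>q. - Y q) = (\<lambda>q. - nabla X Y q)"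
  using nabla_scaleR_right[of "\<lambda>q. -1" X Y] by simp

lemma nabla_diff_right:
  "X \<in> VF \<Longrightarrow> Y \<in> VF \<Longrightarrow> Z \<in> VF \<Longrightarrow> nabla X (\<lambda>q. Y q - Z q) = (\<lambda>q. nabla X Y q - nabla X Z q)"
  using nabla_add_right[of X Y "\<lambda>q. - Z q"] nabla_minus_right[of X Z] by (simp add: vector_fields_minus)

lemma nabla_zero_right: "X \<in> VF \<Longrightarrow> nabla X (\<lambda>q. 0) = (\<lambda>q. 0)"
  using nabla_scaleR_right[of "\<lambda>q. 0" X "\<lambda>q. 0"] by simp

lemma nabla_sum_right:
  "finite I \<Longrightarrow> X \<in> VF \<Longrightarrow> (\<And>i. i \<in> I \<Longrightarrow> Y i \<in> VF) \<Longrightarrow>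
    nabla X (\<lambda>q. \<Sum>i\<in>I. Y i q) = (\<lambda>q. \<Sum>i\<in>I. nabla X (Y i) q)"
  by (induction I rule: finite_induct) (simp_all add: nabla_zero_right nabla_add_right vector_fields_sum)

text \<open>Through torsion-freeness the bracket inherits smoothness, additivity and its Leibniz
  rule from \<open>nabla\<close>, without recourse to coordinates.\<close>

lemma bracket_eq: "X \<in> VF \<Longrightarrow> Y \<in> VF \<Longrightarrow> bracket X Y = (\<lambda>p. nabla X Y p - nabla Y X p)"
  using levi_civita by (auto simp: levi_civita_connection_def)

lemma bracket_field: "X \<in> VF \<Longrightarrow> Y \<in> VF \<Longrightarrow> bracket X Y \<in> VF"
  by (simp add: bracket_eq vector_fields_diff nabla_field)

lemma deriv_along_metric:
  "X \<in> VF \<Longrightarrow> Y \<in> VF \<Longrightarrow> Z \<in> VF \<Longrightarrow>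
    deriv_along X (\<lambda>q. g q (Y q) (Z q)) p = g p (nabla X Y p) (Z p) + g p (Y p) (nabla X Z p)"
  using levi_civita by (simp add: levi_civita_connection_def)

lemma deriv_along_diff:
  assumes "h \<in> SF" "k \<in> SF"
  shows "deriv_along X (\<lambda>q. h q - k q) p = deriv_along X h p - deriv_along X k p"
  using derivative_along_add[OF assms(1) smooth_functions_mult[OF smooth_functions_const[of "-1"] assms(2)], of X p]
    derivative_along_mult[OF smooth_functions_const[of "-1"] assms(2), of X p] by simp

text \<open>Tested on functions, each double bracket becomes four triple derivatives, and the twelve
  cancel in pairs.\<close>

lemma jacobi_identity:
  assumes "X \<in> VF" "Y \<in> VF" "Z \<in> VF"
  shows "bracket X (bracket Y Z) p + bracket Y (bracket Z X) p + bracket Z (bracket X Y) p = 0"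
proof (rule tangent_vector_zeroI)
  fix h assume h: "h \<in> SF"
  have outer: "deriv_along (\<lambda>_. bracket U (bracket V W) p) h p =
      deriv_along U (deriv_along V (deriv_along W h)) p - deriv_along U (deriv_along W (deriv_along V h)) p
      - (deriv_along V (deriv_along W (deriv_along U h)) p - deriv_along W (deriv_along V (deriv_along U h)) p)"
    if "U \<in> VF" "V \<in> VF" "W \<in> VF" for U V W
  proof -
    have "deriv_along (bracket V W) h = (\<lambda>q. deriv_along V (deriv_along W h) q - deriv_along W (deriv_along V h) q)"
      using derivative_along_bracket[OF that(2,3) h] by blast
    then have "deriv_along U (deriv_along (bracket V W) h) p
        = deriv_along U (deriv_along V (deriv_along W h)) p - deriv_along U (deriv_along W (deriv_along V h)) p"
      using that h by (simp add: deriv_along_diff derivative_along_smooth)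
    then show ?thesis
      using derivative_along_bracket[OF that(1) bracket_field[OF that(2,3)] h, of p]
        derivative_along_bracket[OF that(2,3) derivative_along_smooth[OF that(1) h], of p]
      by (simp add: derivative_along_at[of "bracket U (bracket V W)"])
  qed
  show "deriv_along (\<lambda>_. bracket X (bracket Y Z) p + bracket Y (bracket Z X) p + bracket Z (bracket X Y) p) h p = 0"
    using assms
    by (simp add: linear_add[OF derivative_along_linear[OF h]] outer)
qed

section \<open>Tensoriality and symmetries of the curvature\<close>

lemma curvature_skew:
  assumes "X \<in> VF" "Y \<in> VF" "Z \<in> VF"
  shows "curvature A nabla X Y Z p = - curvature A nabla Y X Z p"
proof -
  have "bracket Y X = (\<lambda>q. - bracket X Y q)" using lie_bracket_swap by blast
  then show ?thesis
    using assms by (simp add: curvature_def nabla_minus_left bracket_field)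
qed

lemma curvature_add_3:
  assumes "X \<in> VF" "Y \<in> VF" "Z \<in> VF" "W \<in> VF"
  shows "curvature A nabla X Y (\<lambda>q. Z q + W q) p = curvature A nabla X Y Z p + curvature A nabla X Y W p"
  using assms by (simp add: curvature_def nabla_add_right nabla_field bracket_field)

text \<open>The terms with first derivatives of \<open>h\<close> are symmetric in \<open>X\<close>
  and \<open>Y\<close>; those with second derivatives cancel against the derivative of
  \<open>h\<close> along the bracket.\<close>

lemma curvature_scaleR_3:
  assumes "X \<in> VF" "Y \<in> VF" "Z \<in> VF" and h: "h \<in> SF"
  shows "curvature A nabla X Y (\<lambda>q. h q *\<^sub>R Z q) p = h p *\<^sub>R curvature A nabla X Y Z p"
proof -
  have "nabla U (nabla V (\<lambda>q. h q *\<^sub>R Z q)) p = h p *\<^sub>R nabla U (nabla V Z) p + deriv_along U h p *\<^sub>R nabla V Z p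
      + (deriv_along V h p *\<^sub>R nabla U Z p + deriv_along U (deriv_along V h) p *\<^sub>R Z p)"
    if "U \<in> VF" "V \<in> VF" for U V
    using that assms
    by (simp add: nabla_scaleR_right nabla_add_right nabla_field vector_fields_scaleR derivative_along_smooth)
  then show ?thesis
    using assms
    by (simp add: curvature_def nabla_scaleR_right bracket_field derivative_along_bracket algebra_simps)
qed

lemma bracket_add_right:
  "X \<in> VF \<Longrightarrow> Y \<in> VF \<Longrightarrow> Z \<in> VF \<Longrightarrow> bracket X (\<lambda>q. Y q + Z q) = (\<lambda>q. bracket X Y q + bracket X Z q)"
  by (simp add: bracket_eq nabla_add_right nabla_add_left vector_fields_add algebra_simps)

lemma bracket_scaleR_right:
  "h \<in> SF \<Longrightarrow> X \<in> VF \<Longrightarrow> Y \<in> VF \<Longrightarrow>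
    bracket X (\<lambda>q. h q *\<^sub>R Y q) = (\<lambda>q. h q *\<^sub>R bracket X Y q + deriv_along X h q *\<^sub>R Y q)"
  by (simp add: bracket_eq nabla_scaleR_right nabla_scaleR_left vector_fields_scaleR algebra_simps)

lemma curvature_add_2:
  assumes "X \<in> VF" "Y \<in> VF" "Z \<in> VF" "W \<in> VF"
  shows "curvature A nabla X (\<lambda>q. Y q + W q) Z p = curvature A nabla X Y Z p + curvature A nabla X W Z p"
  using assms by (simp add: curvature_def nabla_add_left nabla_add_right nabla_field bracket_field bracket_add_right)

lemma curvature_scaleR_2:
  assumes "X \<in> VF" "Y \<in> VF" "Z \<in> VF" "h \<in> SF"
  shows "curvature A nabla X (\<lambda>q. h q *\<^sub>R Y q) Z p = h p *\<^sub>R curvature A nabla X Y Z p"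
  using assms
  by (simp add: curvature_def nabla_scaleR_left nabla_scaleR_right nabla_add_left nabla_field bracket_field
      bracket_scaleR_right vector_fields_scaleR derivative_along_smooth algebra_simps)

text \<open>This is what makes the \<open>THE\<close> in \<open>curvature_at\<close> well defined.
  The arguments are exchanged one at a time, the first being reduced to the second by
  skew-symmetry.\<close>

lemma curvature_tensorial:
  assumes F: "X \<in> VF" "Y \<in> VF" "Z \<in> VF" "X' \<in> VF" "Y' \<in> VF" "Z' \<in> VF"
    and "X p = X' p" "Y p = Y' p" "Z p = Z' p"
  shows "curvature A nabla X Y Z p = curvature A nabla X' Y' Z' p"
proof -
  have second: "curvature A nabla U V W p = curvature A nabla U V' W p"
    if "U \<in> VF" "V \<in> VF" "V' \<in> VF" "W \<in> VF" "V p = V' p" for U V V' W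
    by (rule tensorial[where T = "\<lambda>V. curvature A nabla U V W p"])
      (use that in \<open>simp_all add: curvature_add_2 curvature_scaleR_2\<close>)
  have third: "curvature A nabla U V W p = curvature A nabla U V W' p"
    if "U \<in> VF" "V \<in> VF" "W \<in> VF" "W' \<in> VF" "W p = W' p" for U V W W'
    by (rule tensorial[where T = "\<lambda>W. curvature A nabla U V W p"])
      (use that in \<open>simp_all add: curvature_add_3 curvature_scaleR_3\<close>)
  have "curvature A nabla X Y Z p = curvature A nabla X Y' Z' p"
    using second[of X Y Y' Z] third[of X Y' Z Z'] assms by simp
  also have "\<dots> = curvature A nabla X' Y' Z' p"
    using second[of Y' X X' Z'] curvature_skew[of X Y' Z' p] curvature_skew[of X' Y' Z' p] assms by simp
  finally show ?thesis .
qed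

text \<open>Torsion-freeness collects the cyclic sum into double brackets, and Jacobi's identity
  applies.\<close>

lemma curvature_bianchi:
  assumes "X \<in> VF" "Y \<in> VF" "Z \<in> VF"
  shows "curvature A nabla X Y Z p + curvature A nabla Y Z X p + curvature A nabla Z X Y p = 0"
proof -
  have "nabla U (nabla V W) p - nabla U (nabla W V) p - nabla (bracket V W) U p = bracket U (bracket V W) p"
    if "U \<in> VF" "V \<in> VF" "W \<in> VF" for U V W
    using that nabla_diff_right[of U "nabla V W" "nabla W V"]
    by (simp add: bracket_eq[of U] bracket_field nabla_field) (simp add: bracket_eq nabla_field)
  from this[OF assms] this[OF assms(2,3,1)] this[OF assms(3,1,2)] jacobi_identity[OF assms, of p]
  show ?thesis by (simp add: curvature_def algebra_simps)
qed

text \<open>Differentiate the function \<open>g(Z, W)\<close> along \<open>X\<close> and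
  \<open>Y\<close> in both orders and along their bracket. The mixed terms are symmetric in
  \<open>X\<close> and \<open>Y\<close>, and what remains is the claim.\<close>

lemma curvature_metric_skew:
  assumes F: "X \<in> VF" "Y \<in> VF" "Z \<in> VF" "W \<in> VF"
  shows "g p (curvature A nabla X Y Z p) (W p) = - g p (curvature A nabla X Y W p) (Z p)"
proof -
  let ?h = "\<lambda>q. g q (Z q) (W q)"
  have "deriv_along U (deriv_along V ?h) p = g p (nabla U (nabla V Z) p) (W p) + g p (nabla V Z p) (nabla U W p)
      + (g p (nabla U Z p) (nabla V W p) + g p (Z p) (nabla U (nabla V W) p))"
    if "U \<in> VF" "V \<in> VF" for U V
  proof -
    have "deriv_along V ?h = (\<lambda>q. g q (nabla V Z q) (W q) + g q (Z q) (nabla V W q))"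
      using that F deriv_along_metric by blast
    then show ?thesis
      using that F by (simp add: derivative_along_add metric_smooth nabla_field deriv_along_metric)
  qed
  from this[OF F(1,2)] this[OF F(2,1)] derivative_along_bracket[OF F(1,2) metric_smooth[OF F(3,4)], of p]
    deriv_along_metric[OF bracket_field[OF F(1,2)] F(3,4), of p]
  show ?thesis
    by (simp add: curvature_def metric_simps metric_sym[of p "Z p"])
qed

text \<open>Stated for any \<open>nab\<close>, as it also evaluates the semi-symmetric connection.
  The given fields through \<open>u\<close>, \<open>v\<close>, \<open>w\<close> keep the uniqueness
  from being vacuous.\<close>

lemma curvature_at_eqI:
  assumes "X \<in> VF" "Y \<in> VF" "Z \<in> VF" "X p = u" "Y p = v" "Z p = w"
    and "\<And>X Y Z. X \<in> VF \<Longrightarrow> Y \<in> VF \<Longrightarrow> Z \<in> VF \<Longrightarrow> X p = u \<Longrightarrow> Y p = v \<Longrightarrow> Z p = w \<Longrightarrow>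
      curvature A nab X Y Z p = z"
  shows "curvature_at A nab p u v w = z"
  unfolding curvature_at_def by (rule the_equality) (use assms in blast)+

lemma curvature_at_curvature:
  assumes "X \<in> VF" "Y \<in> VF" "Z \<in> VF"
  shows "curvature_at A nabla p (X p) (Y p) (Z p) = curvature A nabla X Y Z p"
  by (rule curvature_at_eqI[OF assms refl refl refl]) (rule curvature_tensorial; use assms in simp)

definition curv :: "'a \<Rightarrow> 'e \<Rightarrow> 'e \<Rightarrow> 'e \<Rightarrow> 'e \<Rightarrow> real" where
  "curv p u v w x = g p (curvature_at A nabla p u v w) x"

lemma curv_fields:
  assumes "X \<in> VF" "Y \<in> VF" "Z \<in> VF"
  shows "curv p (X p) (Y p) (Z p) x = g p (curvature A nabla X Y Z p) x"
  by (simp add: curv_def curvature_at_curvature assms)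

lemma algebraic_curvature_curv: "algebraic_curvature (curv p)"
proof
  fix u v w x
  obtain X where X: "X \<in> VF" "X p = u" by (rule vector_field_through)
  obtain Y where Y: "Y \<in> VF" "Y p = v" by (rule vector_field_through)
  obtain Z where Z: "Z \<in> VF" "Z p = w" by (rule vector_field_through)
  obtain W where W: "W \<in> VF" "W p = x" by (rule vector_field_through)
  note eq = curv_fields[OF X(1) Y(1) Z(1), of p] curv_fields[OF Y(1) X(1) Z(1), of p]
    curv_fields[OF X(1) Y(1) W(1), of p] curv_fields[OF Y(1) Z(1) X(1), of p] curv_fields[OF Z(1) X(1) Y(1), of p]
  note eq = eq[unfolded X(2) Y(2) Z(2) W(2)]
  show "curv p u v w x = - curv p v u w x"
    unfolding eq curvature_skew[OF X(1) Y(1) Z(1)] by (simp add: metric_simps)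
  show "curv p u v w x = - curv p u v x w"
    unfolding eq using curvature_metric_skew[OF X(1) Y(1) Z(1) W(1), of p] by (simp add: W Z)
  show "curv p u v w x + curv p v w u x + curv p w u v x = 0"
    unfolding eq using arg_cong[OF curvature_bianchi[OF X(1) Y(1) Z(1), of p], of "\<lambda>v. g p v x"]
    by (simp add: metric_simps)
qed

text \<open>Linearity is immediate only in this slot; the symmetries of \<open>curv\<close> carry it
  to the other three.\<close>

lemma curv_linear_4: "linear (curv p u v w)"
  unfolding curv_def[abs_def] by (rule metric_linear_right)

lemma curv_linear_3: "linear (\<lambda>w. curv p u v w x)"
  using linear_compose_neg[OF curv_linear_4[of p u v x]] algebraic_curvature.skew34[OF algebraic_curvature_curv, of p u v _ x]
  by simp

lemma curv_linear_1: "linear (\<lambda>u. curv p u v w x)"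
  using curv_linear_3[of p w x v] algebraic_curvature.pair_symmetric[OF algebraic_curvature_curv, of p _ v w x]
  by simp

lemma curv_linear_2: "linear (\<lambda>v. curv p u v w x)"
  using linear_compose_neg[OF curv_linear_1[of p u w x]] algebraic_curvature.skew12[OF algebraic_curvature_curv, of p u _ w x]
  by simp

end

subsection \<open>The structure of an S-manifold\<close>

locale S_levi_civita_manifold =
  S_manifold A g n s f \<xi> \<eta> + levi_civita_manifold A g nabla
  for A :: "('a::{t2_space, second_countable_topology}, 'e::euclidean_space) chart set"
    and g :: "'a \<Rightarrow> 'e \<Rightarrow> 'e \<Rightarrow> real"
    and n s :: nat
    and f :: "'a \<Rightarrow> 'e \<Rightarrow> 'e"
    and \<xi> :: "nat \<Rightarrow> 'a \<Rightarrow> 'e"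
    and \<eta> :: "nat \<Rightarrow> 'a \<Rightarrow> 'e \<Rightarrow> real"
    and nabla :: "('a, 'e) connection"
begin

abbreviation f_field :: "('a \<Rightarrow> 'e) \<Rightarrow> 'a \<Rightarrow> 'e" where
  "f_field X \<equiv> (\<lambda>q. f q (X q))"

definition xi_sum :: "'a \<Rightarrow> 'e" where "xi_sum p = (\<Sum>\<alpha>=1..s. \<xi> \<alpha> p)"

definition eta_sum :: "'a \<Rightarrow> 'e \<Rightarrow> real" where "eta_sum p v = (\<Sum>\<alpha>=1..s. \<eta> \<alpha> p v)"

lemmas f_simps = linear_add[OF f_linear] linear_diff[OF f_linear] linear_neg[OF f_linear]
  linear_scale[OF f_linear] linear_0[OF f_linear] linear_sum[OF f_linear]

lemma eta_sum_metric: "eta_sum p v = g p v (xi_sum p)"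
  by (simp add: eta_sum_def xi_sum_def metric_simps eta_metric)

lemma xi_sum_field: "xi_sum \<in> VF"
  unfolding xi_sum_def[abs_def] by (intro vector_fields_sum xi_smooth) auto

lemma eta_sum_smooth: "X \<in> VF \<Longrightarrow> (\<lambda>q. eta_sum q (X q)) \<in> SF"
  by (simp add: eta_sum_metric metric_smooth xi_sum_field)

lemma eta_sum_f: "eta_sum p (f p v) = 0"
  by (simp add: eta_sum_def eta_f)

lemma eta_sum_xi: "\<alpha> \<in> {1..s} \<Longrightarrow> eta_sum p (\<xi> \<alpha> p) = 1"
  by (simp add: eta_sum_def eta_xi)

lemma vector_decomposition: "v = - f p (f p v) + (\<Sum>\<alpha>=1..s. \<eta> \<alpha> p v *\<^sub>R \<xi> \<alpha> p)"
  by (simp add: f_squared)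

text \<open>The formula for \<open>f\<close> squared shows that the kernel of \<open>f\<close> is
  spanned by the structure fields, with the \<open>\<eta> \<alpha>\<close> as coordinates.\<close>

lemma vector_zeroI:
  assumes "f p v = 0" "\<And>\<alpha>. \<alpha> \<in> {1..s} \<Longrightarrow> \<eta> \<alpha> p v = 0"
  shows "v = 0"
  using vector_decomposition[of v p] assms by (simp add: f_simps)

lemma metric_f_self: "g p v (f p v) = 0"
  using f_skew[of p v v] metric_sym[of p "f p v" v] by simp

lemma bracket_zero_left: "X \<in> VF \<Longrightarrow> bracket (\<lambda>q. 0) X p = 0"
  using nabla_scaleR_left[of "\<lambda>q. 0" "\<lambda>q. 0" X] by (simp add: bracket_eq nabla_zero_right)

lemma bracket_zero_right: "X \<in> VF \<Longrightarrow> bracket X (\<lambda>q. 0) p = 0"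
  using bracket_zero_left lie_bracket_swap[of X "\<lambda>q. 0" p] by simp

lemma two_fundamental_form:
  assumes "\<alpha> \<in> {1..s}" "X \<in> VF" "Y \<in> VF"
  shows "2 * g p (X p) (f p (Y p)) = deriv_along X (\<lambda>q. \<eta> \<alpha> q (Y q)) p
    - deriv_along Y (\<lambda>q. \<eta> \<alpha> q (X q)) p - \<eta> \<alpha> p (bracket X Y p)"
  using fundamental_form_eq[OF assms, of p] by (simp add: fundamental_form_def ext_deriv_def)

text \<open>\<open>L\<^sub>\<xi> \<eta> = 0\<close>\<close>

lemma eta_bracket_xi:
  assumes "\<alpha> \<in> {1..s}" "\<beta> \<in> {1..s}" "X \<in> VF"
  shows "\<eta> \<beta> p (bracket (\<xi> \<alpha>) X p) = deriv_along (\<xi> \<alpha>) (\<lambda>q. \<eta> \<beta> q (X q)) p"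
  using two_fundamental_form[OF assms(2) xi_smooth[OF assms(1)] assms(3), of p] assms
  by (simp add: f_skew f_xi metric_simps eta_xi)

text \<open>\<open>L\<^sub>\<xi> f = 0\<close>, by normality\<close>

lemma bracket_xi_f:
  assumes "\<alpha> \<in> {1..s}" "X \<in> VF"
  shows "bracket (\<xi> \<alpha>) (f_field X) p = f p (bracket (\<xi> \<alpha>) X p)"
proof -
  note V = xi_smooth[OF assms(1)] assms(2) f_smooth[OF assms(2)]
  let ?v = "f p (bracket (\<xi> \<alpha>) X p) - bracket (\<xi> \<alpha>) (f_field X) p"
  have "ext_deriv A (\<eta> \<beta>) (\<xi> \<alpha>) X p = 0" if "\<beta> \<in> {1..s}" for \<beta>
    using fundamental_form_eq[OF that V(1,2), of p] assms(1)
    by (simp add: fundamental_form_def f_skew f_xi metric_simps)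
  then have "nijenhuis A f (\<xi> \<alpha>) X p = 0"
    using normal[OF V(1,2), of p] by simp
  \<comment> \<open>As \<open>f\<close> kills \<open>\<xi> \<alpha>\<close>, two of the four
    Nijenhuis terms drop out and the others are \<open>f p ?v\<close>.\<close>
  then have "f p ?v = 0"
    using assms(1) V by (simp add: nijenhuis_def f_xi bracket_zero_left f_simps)
  moreover have "\<eta> \<beta> p ?v = 0" if "\<beta> \<in> {1..s}" for \<beta>
    using eta_bracket_xi[OF assms(1) that V(3), of p] that
    by (simp add: linear_diff[OF eta_linear] eta_f)
  ultimately have "?v = 0" by (rule vector_zeroI)
  then show ?thesis by simp
qed

lemma bracket_xi_xi:
  assumes "\<alpha> \<in> {1..s}" "\<beta> \<in> {1..s}"
  shows "bracket (\<xi> \<alpha>) (\<xi> \<beta>) p = 0"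
proof (rule vector_zeroI)
  show "f p (bracket (\<xi> \<alpha>) (\<xi> \<beta>) p) = 0"
    using bracket_xi_f[OF assms(1) xi_smooth[OF assms(2)], of p] assms
    by (simp add: f_xi bracket_zero_right xi_smooth)
  show "\<eta> \<gamma> p (bracket (\<xi> \<alpha>) (\<xi> \<beta>) p) = 0" if "\<gamma> \<in> {1..s}" for \<gamma>
    using that assms by (simp add: eta_bracket_xi xi_smooth eta_xi)
qed

text \<open>\<open>L\<^sub>\<xi> \<Phi> = L\<^sub>\<xi> d\<eta> = d L\<^sub>\<xi> \<eta> = 0\<close>\<close>

lemma lie_derivative_fundamental_form:
  assumes a: "\<alpha> \<in> {1..s}" and X: "X \<in> VF" and Y: "Y \<in> VF"
  shows "deriv_along (\<xi> \<alpha>) (\<lambda>q. g q (X q) (f q (Y q))) p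
    = g p (bracket (\<xi> \<alpha>) X p) (f p (Y p)) + g p (X p) (f p (bracket (\<xi> \<alpha>) Y p))"
proof -
  note x = xi_smooth[OF a]
  \<comment> \<open>The Lie derivative along \<open>\<xi> \<alpha>\<close> annihilates
    \<open>\<eta> \<alpha>\<close>, so it acts on \<open>U (\<eta> \<alpha> (V))\<close> only by
    bracketing \<open>U\<close> and \<open>V\<close>.\<close>
  have *: "deriv_along (\<xi> \<alpha>) (deriv_along U (\<lambda>q. \<eta> \<alpha> q (V q))) p
      = deriv_along (bracket (\<xi> \<alpha>) U) (\<lambda>q. \<eta> \<alpha> q (V q)) p
        + deriv_along U (\<lambda>q. \<eta> \<alpha> q (bracket (\<xi> \<alpha>) V q)) p"
    if "U \<in> VF" "V \<in> VF" for U V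
  proof -
    have "deriv_along (\<xi> \<alpha>) (\<lambda>q. \<eta> \<alpha> q (V q)) = (\<lambda>q. \<eta> \<alpha> q (bracket (\<xi> \<alpha>) V q))"
      using eta_bracket_xi[OF a a that(2)] by simp
    then show ?thesis
      using derivative_along_bracket[OF x that(1) eta_smooth[OF a that(2)], of p] by simp
  qed
  have "(\<lambda>q. 2 * g q (X q) (f q (Y q))) = (\<lambda>q. deriv_along X (\<lambda>q. \<eta> \<alpha> q (Y q)) q
      - deriv_along Y (\<lambda>q. \<eta> \<alpha> q (X q)) q - \<eta> \<alpha> q (bracket X Y q))"
    using two_fundamental_form[OF a X Y] by simp
  then have "deriv_along (\<xi> \<alpha>) (\<lambda>q. 2 * g q (X q) (f q (Y q))) p
      = deriv_along (\<xi> \<alpha>) (\<lambda>q. deriv_along X (\<lambda>q. \<eta> \<alpha> q (Y q)) q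
        - deriv_along Y (\<lambda>q. \<eta> \<alpha> q (X q)) q - \<eta> \<alpha> q (bracket X Y q)) p"
    by (rule arg_cong)
  moreover have "deriv_along (\<xi> \<alpha>) (\<lambda>q. 2 * g q (X q) (f q (Y q))) p
      = 2 * deriv_along (\<xi> \<alpha>) (\<lambda>q. g q (X q) (f q (Y q))) p"
    using derivative_along_mult[OF smooth_functions_const[of 2] metric_smooth[OF X f_smooth[OF Y]]] by simp
  moreover have "(\<lambda>q. deriv_along X (\<lambda>q. \<eta> \<alpha> q (Y q)) q - deriv_along Y (\<lambda>q. \<eta> \<alpha> q (X q)) q) \<in> SF"
    using smooth_functions_add[OF derivative_along_smooth[OF X eta_smooth[OF a Y]]
        smooth_functions_mult[OF smooth_functions_const[of "-1"] derivative_along_smooth[OF Y eta_smooth[OF a X]]]]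
    by simp
  ultimately have "2 * deriv_along (\<xi> \<alpha>) (\<lambda>q. g q (X q) (f q (Y q))) p
      = deriv_along (\<xi> \<alpha>) (deriv_along X (\<lambda>q. \<eta> \<alpha> q (Y q))) p
        - deriv_along (\<xi> \<alpha>) (deriv_along Y (\<lambda>q. \<eta> \<alpha> q (X q))) p
        - \<eta> \<alpha> p (bracket (\<xi> \<alpha>) (bracket X Y) p)"
    using X Y a by (simp add: deriv_along_diff derivative_along_smooth eta_smooth bracket_field eta_bracket_xi)
  \<comment> \<open>Jacobi's identity, read as the Leibniz rule for bracketing with
    \<open>\<xi> \<alpha>\<close>.\<close>
  moreover have "\<eta> \<alpha> p (bracket (\<xi> \<alpha>) (bracket X Y) p)
      = \<eta> \<alpha> p (bracket (bracket (\<xi> \<alpha>) X) Y p) + \<eta> \<alpha> p (bracket X (bracket (\<xi> \<alpha>) Y) p)"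
  proof -
    have "bracket Y (\<xi> \<alpha>) = (\<lambda>q. - bracket (\<xi> \<alpha>) Y q)" using lie_bracket_swap by blast
    then have "bracket X (bracket Y (\<xi> \<alpha>)) p = - bracket X (bracket (\<xi> \<alpha>) Y) p"
      using bracket_scaleR_right[OF smooth_functions_const[of "-1"] X bracket_field[OF x Y]] by simp
    then have "bracket (\<xi> \<alpha>) (bracket X Y) p = bracket (bracket (\<xi> \<alpha>) X) Y p + bracket X (bracket (\<xi> \<alpha>) Y) p"
      using jacobi_identity[OF x X Y, of p] lie_bracket_swap[of Y "bracket (\<xi> \<alpha>) X" p]
      by (simp add: algebra_simps)
    then show ?thesis by (simp add: linear_add[OF eta_linear[OF a]])
  qed
  ultimately show ?thesis
    using *[OF X Y] *[OF Y X] two_fundamental_form[OF a bracket_field[OF x X] Y, of p]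
      two_fundamental_form[OF a X bracket_field[OF x Y], of p]
    by simp
qed

lemma lie_derivative_metric:
  assumes "U \<in> VF" "X \<in> VF" "Y \<in> VF"
  shows "g p (nabla X U p) (Y p) + g p (X p) (nabla Y U p)
    = deriv_along U (\<lambda>q. g q (X q) (Y q)) p - g p (bracket U X p) (Y p) - g p (X p) (bracket U Y p)"
  using assms by (simp add: deriv_along_metric bracket_eq metric_simps)

text \<open>The expression is tensorial in \<open>Y\<close>, so it suffices to test the image of
  \<open>f\<close> and the structure fields. On the former it vanishes because \<open>f\<close> and
  the fundamental form are invariant under \<open>\<xi> \<alpha>\<close>, on the latter because the
  forms are and the structure fields commute.\<close>

lemma xi_killing:
  assumes a: "\<alpha> \<in> {1..s}" and X: "X \<in> VF" and Y: "Y \<in> VF"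
  shows "g p (nabla X (\<xi> \<alpha>) p) (Y p) + g p (X p) (nabla Y (\<xi> \<alpha>) p) = 0"
proof -
  let ?T = "\<lambda>W. g p (nabla X (\<xi> \<alpha>) p) (W p) + g p (X p) (nabla W (\<xi> \<alpha>) p)"
  note x = xi_smooth[OF a]
  have f: "?T (f_field W) = 0" if "W \<in> VF" for W
    using lie_derivative_metric[OF x X f_smooth[OF that], of p] lie_derivative_fundamental_form[OF a X that, of p]
    using a that by (simp add: bracket_xi_f)
  have xi: "?T (\<xi> \<beta>) = 0" if b: "\<beta> \<in> {1..s}" for \<beta>
    using lie_derivative_metric[OF x X xi_smooth[OF b], of p] eta_bracket_xi[OF a b X, of p]
    using bracket_xi_xi[OF a b] by (simp add: metric_simps eta_metric[OF b])
  have add: "?T (\<lambda>q. U q + V q) = ?T U + ?T V" if "U \<in> VF" "V \<in> VF" for U V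
    using that x by (simp add: nabla_add_left metric_simps)
  have scale: "?T (\<lambda>q. h q *\<^sub>R U q) = h p * ?T U" if "U \<in> VF" "h \<in> SF" for U h
    using that x by (simp add: nabla_scaleR_left metric_simps distrib_left)
  have sum: "?T (\<lambda>q. \<Sum>\<beta>\<in>I. \<eta> \<beta> q (Y q) *\<^sub>R \<xi> \<beta> q) = 0" if "finite I" "I \<subseteq> {1..s}" for I
    using that
  proof (induction I rule: finite_induct)
    case empty
    then show ?case using nabla_scaleR_left[of "\<lambda>q. 0" "\<lambda>q. 0" "\<xi> \<alpha>"] x by (simp add: metric_simps)
  next
    case (insert b I)
    have "(\<lambda>q. \<Sum>\<beta>\<in>I. \<eta> \<beta> q (Y q) *\<^sub>R \<xi> \<beta> q) \<in> VF" "(\<lambda>q. \<eta> b q (Y q) *\<^sub>R \<xi> b q) \<in> VF"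
      using insert Y by (auto intro!: vector_fields_sum vector_fields_scaleR eta_smooth xi_smooth)
    from add[OF this(2,1)] scale[OF xi_smooth eta_smooth[OF _ Y], of b b] xi[of b] insert
    show ?case by simp
  qed
  have ff: "f_field (f_field Y) \<in> VF" using Y by (intro f_smooth)
  have S: "(\<lambda>q. \<Sum>\<beta>=1..s. \<eta> \<beta> q (Y q) *\<^sub>R \<xi> \<beta> q) \<in> VF"
    using Y by (auto intro!: vector_fields_sum vector_fields_scaleR eta_smooth xi_smooth)
  define W where "W = (\<lambda>q. (-1) *\<^sub>R f q (f q (Y q)) + (\<Sum>\<beta>=1..s. \<eta> \<beta> q (Y q) *\<^sub>R \<xi> \<beta> q))"
  have "?T W = 0"
    unfolding W_def using add[OF vector_fields_cmult[OF ff] S, of "-1"] scale[OF ff smooth_functions_const[of "-1"]]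
      f[OF f_smooth[OF Y]] sum[of "{1..s}"] by simp
  moreover have "W = Y"
    unfolding W_def using vector_decomposition by simp
  ultimately show ?thesis by simp
qed

text \<open>The exterior derivative of \<open>\<eta> \<alpha>\<close> determines the skew part of
  the covariant derivative of \<open>\<xi> \<alpha>\<close>; the Killing equation says that there is
  no symmetric part.\<close>

lemma nabla_xi:
  assumes a: "\<alpha> \<in> {1..s}" and X: "X \<in> VF"
  shows "nabla X (\<xi> \<alpha>) p = - f p (X p)"
proof (rule metric_eqI)
  fix w
  obtain Y where Y: "Y \<in> VF" "Y p = w" by (rule vector_field_through)
  have "2 * g p (X p) (f p w) = g p w (nabla X (\<xi> \<alpha>) p) - g p (X p) (nabla Y (\<xi> \<alpha>) p)"
    using two_fundamental_form[OF a X Y(1), of p] X Y a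
    by (simp add: eta_metric deriv_along_metric xi_smooth bracket_eq metric_simps)
  then show "g p (nabla X (\<xi> \<alpha>) p) w = g p (- f p (X p)) w"
    using xi_killing[OF a X Y(1), of p] Y(2) metric_sym[of p w] by (simp add: metric_simps f_skew)
qed

lemma nabla_xi_sum: "X \<in> VF \<Longrightarrow> nabla X xi_sum p = - real s *\<^sub>R f p (X p)"
  unfolding xi_sum_def[abs_def]
  by (subst nabla_sum_right) (auto simp: xi_smooth nabla_xi sum_negf sum_constant_scaleR)

lemma deriv_along_eta_sum:
  "X \<in> VF \<Longrightarrow> Y \<in> VF \<Longrightarrow>
    deriv_along X (\<lambda>q. eta_sum q (Y q)) p = eta_sum p (nabla X Y p) - s * g p (f p (X p)) (Y p)"
  using metric_sym[of p "Y p"]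
  by (simp add: eta_sum_metric deriv_along_metric xi_sum_field nabla_xi_sum metric_simps)

subsection \<open>The covariant derivative of the structure tensor\<close>

definition nabla_f :: "('a \<Rightarrow> 'e) \<Rightarrow> ('a \<Rightarrow> 'e) \<Rightarrow> 'a \<Rightarrow> 'e" where
  "nabla_f X Y p = nabla X (f_field Y) p - f p (nabla X Y p)"

lemma nabla_f_skew:
  assumes "X \<in> VF" "Y \<in> VF" "Z \<in> VF"
  shows "g p (nabla_f X Y p) (Z p) = - g p (nabla_f X Z p) (Y p)"
proof -
  have "(\<lambda>q. g q (Y q) (f q (Z q))) = (\<lambda>q. -1 * g q (f q (Y q)) (Z q))" by (simp add: f_skew)
  then have "deriv_along X (\<lambda>q. g q (Y q) (f q (Z q))) p = - deriv_along X (\<lambda>q. g q (f q (Y q)) (Z q)) p"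
    using derivative_along_mult[OF smooth_functions_const[of "-1"] metric_smooth[OF f_smooth[OF assms(2)] assms(3)], of X p]
    by simp
  then show ?thesis
    using assms metric_sym[of p "nabla X (f_field Z) p"] metric_sym[of p "f p (nabla X Z p)"]
      f_skew[of p "nabla X Y p" "Z p"] f_skew[of p "Y p" "nabla X Z p"]
    by (simp add: deriv_along_metric f_smooth nabla_f_def metric_simps)
qed

text \<open>Differentiating \<open>nabla V (\<xi> \<alpha>) = - f V\<close> once more. It serves in
  both directions: Bianchi turns it into a constraint on \<open>nabla_f\<close>, and the resulting
  formula for \<open>nabla_f\<close> gives \<open>curv_xi\<close>.\<close>

lemma curvature_xi_nabla_f:
  assumes "X \<in> VF" "Y \<in> VF" "\<alpha> \<in> {1..s}"
  shows "curvature A nabla X Y (\<xi> \<alpha>) p = nabla_f Y X p - nabla_f X Y p"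
proof -
  have "nabla U (nabla V (\<xi> \<alpha>)) p = - nabla U (f_field V) p" if "U \<in> VF" "V \<in> VF" for U V
  proof -
    have "nabla V (\<xi> \<alpha>) = (\<lambda>q. - f q (V q))" using nabla_xi[OF assms(3) that(2)] by blast
    then show ?thesis using that by (simp add: nabla_minus_right f_smooth)
  qed
  then show ?thesis
    using assms by (simp add: curvature_def nabla_xi bracket_field nabla_f_def)
      (simp add: bracket_eq f_simps)
qed

text \<open>\<open>d\<Phi> = 0\<close>, in the form of the first Bianchi identity with one argument equal to \<open>\<xi>\<close>\<close>

lemma nabla_f_cyclic:
  assumes X: "X \<in> VF" and Y: "Y \<in> VF" and Z: "Z \<in> VF"
  shows "g p (nabla_f X Y p) (Z p) + g p (nabla_f Y Z p) (X p) + g p (nabla_f Z X p) (Y p) = 0"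
proof -
  have 1: "1 \<in> {1..s}" using s_pos by simp
  have *: "g p (curvature A nabla U V W p) (\<xi> 1 p) = g p (nabla_f U V p) (W p) - g p (nabla_f V U p) (W p)"
    if "U \<in> VF" "V \<in> VF" "W \<in> VF" for U V W
    using curvature_metric_skew[OF that xi_smooth[OF 1], of p] curvature_xi_nabla_f[OF that(1,2) 1, of p]
    by (simp add: metric_simps)
  have "g p (curvature A nabla X Y Z p) (\<xi> 1 p) + g p (curvature A nabla Y Z X p) (\<xi> 1 p)
      + g p (curvature A nabla Z X Y p) (\<xi> 1 p) = 0"
    using arg_cong[OF curvature_bianchi[OF X Y Z, of p], of "\<lambda>v. g p v (\<xi> 1 p)"] by (simp add: metric_simps)
  then show ?thesis
    using *[OF X Y Z] *[OF Y Z X] *[OF Z X Y] nabla_f_skew[OF X Y Z, of p] nabla_f_skew[OF Y X Z, of p]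
      nabla_f_skew[OF Z X Y, of p] nabla_f_skew[OF X Z Y, of p] nabla_f_skew[OF Y Z X, of p] nabla_f_skew[OF Z Y X, of p]
    by linarith
qed

text \<open>The Leibniz rule for \<open>f\<close> composed with itself, paired with
  \<open>Z\<close>: the composition is known up to the sum of the \<open>\<eta> \<alpha>\<close>
  times \<open>\<xi> \<alpha>\<close>, and differentiating this sum by \<open>nabla_xi\<close> gives
  the two terms on the right.\<close>

lemma nabla_f_f:
  assumes X: "X \<in> VF" and Y: "Y \<in> VF" and Z: "Z \<in> VF"
  shows "g p (nabla_f X (f_field Y) p) (Z p) - g p (nabla_f X Y p) (f p (Z p))
    = - eta_sum p (Y p) * g p (f p (X p)) (Z p) - g p (f p (X p)) (Y p) * eta_sum p (Z p)"
proof -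
  have ff: "f_field (f_field Y) = (\<lambda>q. (\<Sum>\<alpha>=1..s. \<eta> \<alpha> q (Y q) *\<^sub>R \<xi> \<alpha> q) - Y q)"
    by (simp add: f_squared)
  have D: "deriv_along X (\<lambda>q. \<eta> \<alpha> q (Y q)) p = \<eta> \<alpha> p (nabla X Y p) - g p (f p (X p)) (Y p)"
    if "\<alpha> \<in> {1..s}" for \<alpha>
    using that X Y metric_sym[of p "Y p" "f p (X p)"]
    by (simp add: eta_metric deriv_along_metric xi_smooth nabla_xi metric_simps)
  have "nabla X (f_field (f_field Y)) p = (\<Sum>\<alpha>=1..s. \<eta> \<alpha> p (Y p) *\<^sub>R (- f p (X p))
      + (\<eta> \<alpha> p (nabla X Y p) - g p (f p (X p)) (Y p)) *\<^sub>R \<xi> \<alpha> p) - nabla X Y p"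
  proof -
    have T: "(\<lambda>q. \<eta> \<alpha> q (Y q) *\<^sub>R \<xi> \<alpha> q) \<in> VF" if "\<alpha> \<in> {1..s}" for \<alpha>
      using that Y by (intro vector_fields_scaleR eta_smooth xi_smooth)
    have "nabla X (f_field (f_field Y)) p
        = (\<Sum>\<alpha>=1..s. nabla X (\<lambda>q. \<eta> \<alpha> q (Y q) *\<^sub>R \<xi> \<alpha> q) p) - nabla X Y p"
    proof -
      have "(\<lambda>q. \<Sum>\<alpha>=1..s. \<eta> \<alpha> q (Y q) *\<^sub>R \<xi> \<alpha> q) \<in> VF"
        by (rule vector_fields_sum) (use T in auto)
      moreover have "nabla X (\<lambda>q. \<Sum>\<alpha>=1..s. \<eta> \<alpha> q (Y q) *\<^sub>R \<xi> \<alpha> q)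
          = (\<lambda>q. \<Sum>\<alpha>=1..s. nabla X (\<lambda>q. \<eta> \<alpha> q (Y q) *\<^sub>R \<xi> \<alpha> q) q)"
        by (rule nabla_sum_right) (use X T in auto)
      ultimately show ?thesis
        unfolding ff using nabla_diff_right[OF X _ Y] by simp
    qed
    also have "(\<Sum>\<alpha>=1..s. nabla X (\<lambda>q. \<eta> \<alpha> q (Y q) *\<^sub>R \<xi> \<alpha> q) p)
        = (\<Sum>\<alpha>=1..s. \<eta> \<alpha> p (Y p) *\<^sub>R (- f p (X p))
          + (\<eta> \<alpha> p (nabla X Y p) - g p (f p (X p)) (Y p)) *\<^sub>R \<xi> \<alpha> p)"
      by (intro sum.cong refl) (use X Y D in \<open>simp add: nabla_scaleR_right eta_smooth xi_smooth nabla_xi\<close>)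
    finally show ?thesis .
  qed
  also have "\<dots> = f p (f p (nabla X Y p)) - eta_sum p (Y p) *\<^sub>R f p (X p) - g p (f p (X p)) (Y p) *\<^sub>R xi_sum p"
    by (simp add: f_squared sum.distrib sum_subtractf scaleR_diff_left sum_negf eta_sum_def xi_sum_def scaleR_sum_left
        scaleR_sum_right)
  finally have "nabla_f X (f_field Y) p + f p (nabla_f X Y p)
      = - eta_sum p (Y p) *\<^sub>R f p (X p) - g p (f p (X p)) (Y p) *\<^sub>R xi_sum p"
    by (simp add: nabla_f_def f_simps)
  from arg_cong[OF this, of "\<lambda>v. g p v (Z p)"] show ?thesis
    using metric_sym[of p "xi_sum p" "Z p"] f_skew[of p "nabla_f X Y p" "Z p"]
    by (simp add: metric_simps eta_sum_metric[of p "Z p"])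
qed

text \<open>With brackets written through the torsion-free connection, the derivatives of
  \<open>X\<close> and \<open>Y\<close> cancel and only those of \<open>f\<close> remain.\<close>

lemma nijenhuis_nabla_f:
  assumes X: "X \<in> VF" and Y: "Y \<in> VF"
  shows "nijenhuis A f X Y p = nabla_f (f_field X) Y p - nabla_f (f_field Y) X p
    + f p (nabla_f Y X p) - f p (nabla_f X Y p)"
  using X Y by (simp add: nijenhuis_def bracket_eq f_smooth nabla_f_def f_simps)

lemma nabla_f_normal:
  assumes X: "X \<in> VF" and Y: "Y \<in> VF" and Z: "Z \<in> VF"
  shows "g p (nabla_f (f_field X) Y p) (Z p) - g p (nabla_f (f_field Y) X p) (Z p)
    - g p (nabla_f Y X p) (f p (Z p)) + g p (nabla_f X Y p) (f p (Z p))
    = 2 * g p (f p (X p)) (Y p) * eta_sum p (Z p)"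
proof -
  have "(\<Sum>\<alpha>=1..s. ext_deriv A (\<eta> \<alpha>) X Y p *\<^sub>R \<xi> \<alpha> p) = g p (X p) (f p (Y p)) *\<^sub>R xi_sum p"
    using X Y by (simp add: fundamental_form_eq[symmetric] fundamental_form_def xi_sum_def scaleR_sum_right)
  then have "nabla_f (f_field X) Y p - nabla_f (f_field Y) X p + f p (nabla_f Y X p) - f p (nabla_f X Y p)
      + (2 * g p (X p) (f p (Y p))) *\<^sub>R xi_sum p = 0"
    using normal[OF X Y, of p] by (simp add: nijenhuis_nabla_f[OF X Y])
  from arg_cong[OF this, of "\<lambda>v. g p v (Z p)"] show ?thesis
    using metric_sym[of p "xi_sum p" "Z p"] f_skew[of p "nabla_f X Y p" "Z p"] f_skew[of p "nabla_f Y X p" "Z p"]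
      f_skew[of p "X p" "Y p"]
    by (simp add: metric_simps eta_sum_metric[of p "Z p"])
qed

text \<open>The cyclic sum, normality, the derivative of \<open>f\<^sup>2\<close> and skew-symmetry form a linear system for the numbers
  \<open>g((\<nabla>\<^sub>X f) Y, Z)\<close>, in which all terms but those at \<open>(Z; fX, Y)\<close> cancel.\<close>

lemma nabla_f_of_f:
  assumes X: "X \<in> VF" and Z: "Z \<in> VF"
  shows "nabla_f Z (f_field X) p = g p (f p (X p)) (Z p) *\<^sub>R xi_sum p"
proof (rule metric_eqI)
  fix w
  obtain Y where Y: "Y \<in> VF" "Y p = w" by (rule vector_field_through)
  note F = f_smooth[OF X] f_smooth[OF Y(1)]
  have "g p (nabla_f Z (f_field X) p) (Y p) = g p (f p (X p)) (Z p) * eta_sum p (Y p)"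
  proof -
    \<comment> \<open>These signs reduce all pairings to three, so that the relations below combine
      by linear arithmetic.\<close>
    have s: "g p (f p (Y p)) (X p) = - g p (f p (X p)) (Y p)"
      "g p (f p (Z p)) (X p) = - g p (f p (X p)) (Z p)"
      "g p (f p (Z p)) (Y p) = - g p (f p (Y p)) (Z p)"
      using f_skew[of p "X p" "Y p"] f_skew[of p "X p" "Z p"] f_skew[of p "Y p" "Z p"]
        metric_sym[of p "X p"] metric_sym[of p "Y p"] by simp_all
    show ?thesis
      using nabla_f_normal[OF X Y(1) Z, of p] nabla_f_cyclic[OF F(1) Y(1) Z, of p] nabla_f_cyclic[OF F(2) X Z, of p]
        nabla_f_f[OF Y(1) X Z, of p] nabla_f_f[OF X Y(1) Z, of p] nabla_f_f[OF Z X Y(1), of p]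
        nabla_f_skew[OF Y(1) Z F(1), of p] nabla_f_skew[OF X Z F(2), of p] nabla_f_skew[OF Z F(2) X, of p]
      unfolding s by (simp add: algebra_simps)
  qed
  then show "g p (nabla_f Z (f_field X) p) w = g p (g p (f p (X p)) (Z p) *\<^sub>R xi_sum p) w"
    using Y(2) metric_sym[of p "xi_sum p" w] by (simp add: metric_simps eta_sum_metric)
qed

text \<open>Again by tensoriality in \<open>Y\<close>: \<open>nabla_f_of_f\<close> covers the image
  of \<open>f\<close>, and on a structure field, where \<open>f\<close> vanishes, only
  \<open>- f (nabla X (\<xi> \<alpha>))\<close> is left, which is \<open>f\<close> squared applied
  to \<open>X\<close>.\<close>

lemma nabla_f_eq:
  assumes X: "X \<in> VF" and Y: "Y \<in> VF"
  shows "nabla_f X Y p = g p (f p (X p)) (f p (Y p)) *\<^sub>R xi_sum p + eta_sum p (Y p) *\<^sub>R f p (f p (X p))"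
proof -
  let ?T = "\<lambda>W. nabla_f X W p"
  have add: "?T (\<lambda>q. U q + V q) = ?T U + ?T V" if "U \<in> VF" "V \<in> VF" for U V
    using that X by (simp add: nabla_f_def f_simps nabla_add_right f_smooth)
  have scale: "?T (\<lambda>q. h q *\<^sub>R U q) = h p *\<^sub>R ?T U" if "U \<in> VF" "h \<in> SF" for U h
    using that X by (simp add: nabla_f_def f_simps nabla_scaleR_right f_smooth algebra_simps)
  have xi: "?T (\<xi> \<alpha>) = f p (f p (X p))" if "\<alpha> \<in> {1..s}" for \<alpha>
    using that X by (simp add: nabla_f_def f_xi nabla_zero_right nabla_xi f_simps)
  have sum: "?T (\<lambda>q. \<Sum>\<beta>\<in>I. \<eta> \<beta> q (Y q) *\<^sub>R \<xi> \<beta> q) = (\<Sum>\<beta>\<in>I. \<eta> \<beta> p (Y p)) *\<^sub>R f p (f p (X p))"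
    if "finite I" "I \<subseteq> {1..s}" for I
    using that
  proof (induction I rule: finite_induct)
    case empty
    then show ?case using X by (simp add: nabla_f_def f_simps nabla_zero_right)
  next
    case (insert b I)
    have "(\<lambda>q. \<Sum>\<beta>\<in>I. \<eta> \<beta> q (Y q) *\<^sub>R \<xi> \<beta> q) \<in> VF" "(\<lambda>q. \<eta> b q (Y q) *\<^sub>R \<xi> b q) \<in> VF"
      using insert Y by (auto intro!: vector_fields_sum vector_fields_scaleR eta_smooth xi_smooth)
    from add[OF this(2,1)] scale[OF xi_smooth eta_smooth[OF _ Y], of b b] xi[of b] insert
    show ?case by (simp add: scaleR_add_left)
  qed
  have ff: "f_field (f_field Y) \<in> VF" using Y by (intro f_smooth)
  have S: "(\<lambda>q. \<Sum>\<beta>=1..s. \<eta> \<beta> q (Y q) *\<^sub>R \<xi> \<beta> q) \<in> VF"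
    using Y by (auto intro!: vector_fields_sum vector_fields_scaleR eta_smooth xi_smooth)
  have "?T (\<lambda>q. (-1) *\<^sub>R f q (f q (Y q)) + (\<Sum>\<beta>=1..s. \<eta> \<beta> q (Y q) *\<^sub>R \<xi> \<beta> q))
      = - (g p (f p (f p (Y p))) (X p) *\<^sub>R xi_sum p) + eta_sum p (Y p) *\<^sub>R f p (f p (X p))"
    using add[OF vector_fields_cmult[OF ff] S, of "-1"] scale[OF ff smooth_functions_const[of "-1"]]
      nabla_f_of_f[OF f_smooth[OF Y] X, of p] sum[of "{1..s}"] by (simp add: eta_sum_def)
  moreover have "(\<lambda>q. (-1) *\<^sub>R f q (f q (Y q)) + (\<Sum>\<beta>=1..s. \<eta> \<beta> q (Y q) *\<^sub>R \<xi> \<beta> q)) = Y"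
    using vector_decomposition by simp
  moreover have "g p (f p (f p (Y p))) (X p) = - g p (f p (X p)) (f p (Y p))"
    using f_skew[of p "f p (Y p)" "X p"] metric_sym[of p "f p (Y p)" "f p (X p)"] by simp
  ultimately show ?thesis by simp
qed

subsection \<open>Curvature identities on an S-manifold\<close>

lemma metric_ff: "g p (f p (f p u)) v = - g p (f p u) (f p v)"
  using f_skew[of p "f p u" v] by simp

lemma curv_xi:
  assumes "\<alpha> \<in> {1..s}"
  shows "curv p u v (\<xi> \<alpha> p) x
    = eta_sum p v * g p (f p u) (f p x) - eta_sum p u * g p (f p v) (f p x)"
proof -
  obtain X where X: "X \<in> VF" "X p = u" by (rule vector_field_through)
  obtain Y where Y: "Y \<in> VF" "Y p = v" by (rule vector_field_through)
  show ?thesis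
    using curv_fields[OF X(1) Y(1) xi_smooth[OF assms], of p x] X Y
      curvature_xi_nabla_f[OF X(1) Y(1) assms, of p] metric_sym[of p "f p v" "f p u"]
    by (simp add: nabla_f_eq metric_simps metric_ff)
qed

text \<open>As \<open>f\<close> is skew, the left side pairs the commutator of R(u, v) and
  \<open>f\<close>, applied to \<open>w\<close>, with \<open>x\<close>. The factor \<open>s\<close>
  comes from the derivative of \<open>xi_sum\<close>, both directly and inside the derivative of
  \<open>eta_sum\<close>.\<close>

lemma curv_f:
  assumes w: "eta_sum p w = 0" and x: "eta_sum p x = 0"
  shows "curv p u v (f p w) x + curv p u v w (f p x) = real s *
    (g p (f p u) w * g p (f p v) (f p x) - g p (f p v) (f p w) * g p (f p u) x
     - g p (f p v) w * g p (f p u) (f p x) + g p (f p u) (f p w) * g p (f p v) x)"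
proof -
  obtain X where X: "X \<in> VF" "X p = u" by (rule vector_field_through)
  obtain Y where Y: "Y \<in> VF" "Y p = v" by (rule vector_field_through)
  obtain Z where Z: "Z \<in> VF" "Z p = w" by (rule vector_field_through)
  have xx: "g p (xi_sum p) x = 0" using x metric_sym[of p x] by (simp add: eta_sum_metric)
  have first: "nabla U (f_field V) q = f q (nabla U V q) + (g q (f q (U q)) (f q (V q)) *\<^sub>R xi_sum q
      + eta_sum q (V q) *\<^sub>R f q (f q (U q)))" if "U \<in> VF" "V \<in> VF" for U V q
    using nabla_f_eq[OF that, of q] by (simp add: nabla_f_def algebra_simps)
  \<comment> \<open>\<open>eta_sum\<close> vanishes on \<open>Z\<close> at \<open>p\<close> only, so
    its derivative survives. The terms with \<open>eta_sum\<close> of \<open>nabla U Z\<close> and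
    of \<open>nabla V Z\<close> are symmetric under exchange of \<open>U\<close> and
    \<open>V\<close> and cancel in the curvature.\<close>
  have second: "g p (nabla U (nabla V (f_field Z)) p) x = g p (f p (nabla U (nabla V Z) p)) x
      - eta_sum p (nabla V Z p) * g p (f p (U p)) (f p x)
      - s * g p (f p (V p)) (f p w) * g p (f p (U p)) x
      - (eta_sum p (nabla U Z p) - s * g p (f p (U p)) w) * g p (f p (V p)) (f p x)"
    if "U \<in> VF" "V \<in> VF" for U V
  proof -
    have "nabla V (f_field Z) = (\<lambda>q. f q (nabla V Z q) + (g q (f q (V q)) (f q (Z q)) *\<^sub>R xi_sum q
      + eta_sum q (Z q) *\<^sub>R f q (f q (V q))))"
      using first[OF that(2) Z(1)] by blast
    then show ?thesis
      using that Z w xx deriv_along_eta_sum[OF that(1) Z(1), of p]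
      by (simp add: nabla_add_right nabla_scaleR_right f_smooth nabla_field vector_fields_add vector_fields_scaleR
          metric_smooth xi_sum_field eta_sum_smooth first metric_simps nabla_xi_sum metric_ff)
  qed
  have third: "g p (nabla (bracket X Y) (f_field Z) p) x = g p (f p (nabla (bracket X Y) Z p)) x"
    using first[OF bracket_field[OF X(1) Y(1)] Z(1), of p] Z w xx by (simp add: metric_simps)
  have "curv p u v (f p w) x = g p (curvature A nabla X Y (f_field Z) p) x"
    using curv_fields[OF X(1) Y(1) f_smooth[OF Z(1)], of p x] X Y Z by simp
  moreover have "curv p u v w (f p x) = - g p (f p (curvature A nabla X Y Z p)) x"
    using curv_fields[OF X(1) Y(1) Z(1), of p "f p x"] X Y Z by (simp add: f_skew)
  ultimately show ?thesis
    using second[OF X(1) Y(1)] second[OF Y(1) X(1)] third X(2) Y(2)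
    by (simp add: curvature_def metric_simps f_simps algebra_simps)
qed

subsection \<open>The semi-symmetric non-metric connection\<close>

abbreviation nabla_ss :: "('a, 'e) connection" where
  "nabla_ss \<equiv> semi_symmetric_non_metric_connection s \<eta> nabla"

lemma nabla_ss_eq: "nabla_ss X Y = (\<lambda>q. nabla X Y q + eta_sum q (Y q) *\<^sub>R X q)"
  by (auto simp: semi_symmetric_non_metric_connection_def eta_sum_def)

lemma eta_sum_linear: "linear (eta_sum p)"
  unfolding eta_sum_metric[abs_def] by (rule metric_linear_left)

text \<open>The terms with \<open>s\<close> come from differentiating \<open>eta_sum\<close> on
  \<open>Z\<close>; the multiples of \<open>nabla U V\<close> are absorbed by the bracket.\<close>

lemma curvature_nabla_ss:
  assumes "X \<in> VF" "Y \<in> VF" "Z \<in> VF"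
  shows "curvature A nabla_ss X Y Z p = curvature A nabla X Y Z p
    - (s * g p (f p (X p)) (Z p)) *\<^sub>R Y p + (s * g p (f p (Y p)) (Z p)) *\<^sub>R X p
    + eta_sum p (Z p) *\<^sub>R (eta_sum p (Y p) *\<^sub>R X p - eta_sum p (X p) *\<^sub>R Y p)"
proof -
  have "nabla_ss U (nabla_ss V Z) p = nabla U (nabla V Z) p
      + eta_sum p (Z p) *\<^sub>R nabla U V p + (eta_sum p (nabla U Z p) - s * g p (f p (U p)) (Z p)) *\<^sub>R V p
      + (eta_sum p (nabla V Z p) + eta_sum p (Z p) * eta_sum p (V p)) *\<^sub>R U p"
    if "U \<in> VF" "V \<in> VF" for U V
    using that assms
    by (simp add: nabla_ss_eq nabla_add_right nabla_field vector_fields_scaleR eta_sum_smooth nabla_scaleR_right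
        deriv_along_eta_sum linear_add[OF eta_sum_linear] linear_scale[OF eta_sum_linear])
  from this[OF assms(1,2)] this[OF assms(2,1)] show ?thesis
    using assms by (simp add: curvature_def nabla_ss_eq[of "bracket X Y"]) (simp add: bracket_eq algebra_simps)
qed

text \<open>Kept for arbitrary \<open>u\<close> and \<open>v\<close>, so that it also applies to the
  diagonal terms of the scalar curvature, where it gives 0.\<close>

lemma sectional_curvature_nabla_ss:
  "sectional_curvature A g nabla_ss p u v = curv p u v v u - s * g p (f p u) v * g p u v
    + eta_sum p v * (eta_sum p v * g p u u - eta_sum p u * g p u v)"
proof -
  obtain X where X: "X \<in> VF" "X p = u" by (rule vector_field_through)
  obtain Y where Y: "Y \<in> VF" "Y p = v" by (rule vector_field_through)
  have "curvature_at A nabla_ss p u v v = curvature_at A nabla p u v v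
    - (s * g p (f p u) v) *\<^sub>R v + (s * g p (f p v) v) *\<^sub>R u
    + eta_sum p v *\<^sub>R (eta_sum p v *\<^sub>R u - eta_sum p u *\<^sub>R v)"
    by (rule curvature_at_eqI[OF X(1) Y(1) Y(1) X(2) Y(2) Y(2)])
      (auto simp: curvature_nabla_ss curvature_at_curvature[symmetric])
  then show ?thesis
    using metric_f_self[of p v] metric_sym[of p v]
    by (simp add: sectional_curvature_def curv_def metric_simps)
qed

section \<open>Constant curvature on the distribution L\<close>

lemma L_distribution_iff: "u \<in> L_distribution g s \<xi> p \<longleftrightarrow> (\<forall>\<alpha>\<in>{1..s}. \<eta> \<alpha> p u = 0)"
  by (simp add: L_distribution_def eta_metric)

lemma L_eta_sum: "u \<in> L_distribution g s \<xi> p \<Longrightarrow> eta_sum p u = 0"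
  by (simp add: L_distribution_iff eta_sum_def)

lemma L_f_f: "u \<in> L_distribution g s \<xi> p \<Longrightarrow> f p (f p u) = - u"
  by (simp add: L_distribution_iff f_squared)

lemma f_in_L: "f p u \<in> L_distribution g s \<xi> p"
  by (simp add: L_distribution_iff eta_f)

lemma L_add: "u \<in> L_distribution g s \<xi> p \<Longrightarrow> v \<in> L_distribution g s \<xi> p \<Longrightarrow> u + v \<in> L_distribution g s \<xi> p"
  by (simp add: L_distribution_def metric_simps)

lemma L_scaleR: "u \<in> L_distribution g s \<xi> p \<Longrightarrow> a *\<^sub>R u \<in> L_distribution g s \<xi> p"
  by (simp add: L_distribution_def metric_simps)

lemma L_metric_f_f:
  "u \<in> L_distribution g s \<xi> p \<Longrightarrow> g p (f p u) (f p v) = g p u v"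
  by (simp add: metric_f_f L_distribution_iff)

text \<open>Subtracting a multiple of \<open>u\<close> from \<open>v\<close> changes neither side,
  and both scale alike. Gram-Schmidt thus reduces the claim to orthonormal pairs, apart from the
  degenerate cases \<open>u = 0\<close> and \<open>w = 0\<close>.\<close>

lemma curv_of_constant_L_sectional_curvature:
  assumes c: "constant_L_sectional_curvature A g s \<xi> nabla_ss c"
    and u: "u \<in> L_distribution g s \<xi> p" and v: "v \<in> L_distribution g s \<xi> p"
  shows "curv p u v v u = c * (g p u u * g p v v - (g p u v)\<^sup>2)"
proof (cases "u = 0")
  case True
  then show ?thesis by (simp add: linear_0[OF curv_linear_4] metric_simps)
next
  case False
  interpret algebraic_curvature "curv p" by (rule algebraic_curvature_curv)
  have diag: "curv p a a b d = 0" "curv p b d a a = 0" for a b d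
    using skew12[of a a b d] skew34[of b d a a] by simp_all
  define a where "a = g p u v / g p u u"
  define w where "w = v - a *\<^sub>R u"
  have uu: "g p u u > 0" using metric_pos[OF False] .
  have uw: "g p u w = 0" using uu by (simp add: w_def metric_simps a_def)
  have wL: "w \<in> L_distribution g s \<xi> p"
    using L_add[OF v L_scaleR[OF u, of "-a"]] by (simp add: w_def)
  have vw: "v = w + a *\<^sub>R u" by (simp add: w_def)
  have curv_vw: "curv p u v v u = curv p u w w u"
    by (simp add: vw linear_add[OF curv_linear_2] linear_add[OF curv_linear_3] linear_scale[OF curv_linear_2]
        linear_scale[OF curv_linear_3] diag)
  have gram: "g p u u * g p v v - (g p u v)\<^sup>2 = g p u u * g p w w"
    using uw metric_sym[of p w u] by (simp add: vw metric_simps power2_eq_square algebra_simps)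
  have "curv p u w w u = c * (g p u u * g p w w)"
  proof (cases "w = 0")
    case True
    then show ?thesis by (simp add: linear_0[OF curv_linear_3] metric_simps)
  next
    case False
    have ww: "g p w w > 0" using metric_pos[OF False] .
    define k where "k = 1 / sqrt (g p u u)"
    define l where "l = 1 / sqrt (g p w w)"
    have kl: "k * k * g p u u = 1" "l * l * g p w w = 1" using uu ww by (simp_all add: k_def l_def)
    define x where "x = k *\<^sub>R u"
    define y where "y = l *\<^sub>R w"
    have xy: "x \<in> L_distribution g s \<xi> p" "y \<in> L_distribution g s \<xi> p" "g p x x = 1" "g p y y = 1" "g p x y = 0"
      using kl uw u wL by (simp_all add: x_def y_def L_scaleR metric_simps)
    then have "sectional_curvature A g nabla_ss p x y = c"
      using c unfolding constant_L_sectional_curvature_def by blast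
    then have "curv p x y y x = c"
      using xy by (simp add: sectional_curvature_nabla_ss L_eta_sum)
    moreover have "curv p x y y x = (k * k) * (l * l) * curv p u w w u"
      by (simp add: x_def y_def linear_scale[OF curv_linear_1] linear_scale[OF curv_linear_2]
          linear_scale[OF curv_linear_3] linear_scale[OF curv_linear_4])
    ultimately have "c * (g p u u * g p w w) = (k * k * g p u u) * (l * l * g p w w) * curv p u w w u"
      by (simp add: ac_simps)
    then show ?thesis unfolding kl by simp
  qed
  then show ?thesis using curv_vw gram by simp
qed

text \<open>The difference of the two sides is an algebraic curvature tensor whose sectional values
  on L vanish.\<close>

lemma curv_L:
  assumes c: "constant_L_sectional_curvature A g s \<xi> nabla_ss c"
    and L: "u \<in> L_distribution g s \<xi> p" "v \<in> L_distribution g s \<xi> p"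
      "w \<in> L_distribution g s \<xi> p" "x \<in> L_distribution g s \<xi> p"
  shows "curv p u v w x = c * (g p v w * g p u x - g p u w * g p v x)"
proof -
  let ?F = "\<lambda>u v w x. curv p u v w x - c * (g p v w * g p u x - g p u w * g p v x)"
  interpret C: algebraic_curvature "curv p" by (rule algebraic_curvature_curv)
  interpret F: algebraic_curvature ?F
  proof
    fix u v w x
    show "?F u v w x = - ?F v u w x" using C.skew12[of u v w x] by (simp add: algebra_simps)
    show "?F u v w x = - ?F u v x w" using C.skew34[of u v w x] by (simp add: algebra_simps)
    show "?F u v w x + ?F v w u x + ?F w u v x = 0"
      using C.bianchi[of u v w x] metric_sym[of p v u] metric_sym[of p w u] metric_sym[of p w v]
      by (simp add: algebra_simps)
  qed
  have "?F u v w x = 0"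
  proof (rule F.zero_of_sectional_zero[where S = "L_distribution g s \<xi> p"])
    show "?F (u + u') v w x = ?F u v w x + ?F u' v w x" for u u' v w x
      by (simp add: linear_add[OF curv_linear_1] metric_simps algebra_simps)
    show "?F u v v u = 0" if "u \<in> L_distribution g s \<xi> p" "v \<in> L_distribution g s \<xi> p" for u v
      using curv_of_constant_L_sectional_curvature[OF c that] metric_sym[of p v u]
      by (simp add: power2_eq_square algebra_simps)
  qed (use L L_add in auto)
  then show ?thesis by simp
qed

theorem constant_L_sectional_curvature_value:
  assumes c: "constant_L_sectional_curvature A g s \<xi> nabla_ss c" and n: "n \<ge> 2"
  shows "c = s"
proof -
  fix p :: 'a
  let ?X = "(\<lambda>\<alpha>. \<xi> \<alpha> p) ` {1..s}"
  have card: "card ?X \<le> s" using card_image_le[of "{1..s}" "\<lambda>\<alpha>. \<xi> \<alpha> p"] by simp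
  have "card ?X < DIM('e)" using card n dimension by simp
  then obtain u where u: "g p u u = 1" "\<forall>w\<in>?X. g p u w = 0"
    by (rule exists_unit_orthogonal[rotated]) (auto intro: that)
  \<comment> \<open>There are at most \<open>s + 2\<close> conditions in dimension
    \<open>2 n + s\<close>, and \<open>n \<ge> 2\<close> leaves room for \<open>v\<close>.\<close>
  have "card (insert u (insert (f p u) ?X)) < DIM('e)"
  proof -
    have "card (insert u (insert (f p u) ?X)) \<le> Suc (Suc (card ?X))"
      by (intro order_trans[OF card_insert_le_m1] card_insert_le_m1) auto
    then show ?thesis using card n dimension by simp
  qed
  then obtain v where v: "g p v v = 1" "\<forall>w\<in>insert u (insert (f p u) ?X). g p v w = 0"
    by (rule exists_unit_orthogonal[rotated]) (auto intro: that)
  have L: "u \<in> L_distribution g s \<xi> p" "v \<in> L_distribution g s \<xi> p"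
    using u v by (auto simp: L_distribution_def)
  have uv: "g p u v = 0" "g p v u = 0" "g p (f p u) v = 0" "g p (f p v) u = 0"
    using v(2) metric_sym[of p v] metric_sym[of p u "f p v"] f_skew[of p u v] by auto
  \<comment> \<open>In \<open>curv_f\<close> with \<open>w = u\<close> and \<open>x = f p v\<close>
    only the product of \<open>g(fu, fu)\<close> and \<open>g(fv, fv)\<close> survives, and it
    equals 1.\<close>
  have "curv p u v (f p u) (f p v) + curv p u v u (f p (f p v)) = s"
    using curv_f[of p u "f p v" u v] L u v uv metric_f_self[of p u] metric_f_self[of p v]
      metric_sym[of p "f p v" v] metric_sym[of p "f p u" u] metric_sym[of p "f p v" "f p u"]
    by (simp add: L_eta_sum eta_sum_f L_metric_f_f L_f_f metric_simps)
  moreover have "curv p u v (f p u) (f p v) = 0"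
    using curv_L[OF c L f_in_L f_in_L, of u v] uv metric_f_self[of p u] metric_sym[of p v] by simp
  moreover have "curv p u v u (f p (f p v)) = c"
    using curv_L[OF c L L, of] u v uv by (simp add: L_f_f[OF L(2)] linear_neg[OF curv_linear_4])
  ultimately show ?thesis by simp
qed

section \<open>Scalar curvature in an arbitrary orthonormal frame\<close>

lemma f_f_f: "f p (f p (f p v)) = - f p v"
  by (simp only: f_squared[of p "f p v"]) (simp add: eta_f)

lemma curv_xi_part:
  "curv p u v (\<Sum>\<alpha>=1..s. \<eta> \<alpha> p w *\<^sub>R \<xi> \<alpha> p) x
    = eta_sum p w * (eta_sum p v * g p (f p u) (f p x) - eta_sum p u * g p (f p v) (f p x))"
  by (simp add: linear_sum[OF curv_linear_3] linear_scale[OF curv_linear_3] curv_xi eta_sum_def[of p w] sum_distrib_right)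

text \<open>Splits \<open>w\<close> into its projection to L, which is \<open>- f\<close> squared,
  and its vertical part. The third slot is chosen because \<open>curv_xi\<close> evaluates it; the
  symmetries of \<open>curv\<close> bring the other arguments there.\<close>

lemma curv_decomposition_3:
  "curv p u v w x = curv p u v (- f p (f p w)) x
    + eta_sum p w * (eta_sum p v * g p (f p u) (f p x) - eta_sum p u * g p (f p v) (f p x))"
  using arg_cong[OF vector_decomposition[of w p], of "\<lambda>w. curv p u v w x"]
  by (simp only: linear_add[OF curv_linear_3] curv_xi_part)

text \<open>All four arguments are projected to L in turn. The first two projections leave the
  quadratic terms in \<open>eta_sum\<close>; in the last two the other arguments already lie in L,
  so nothing is added.\<close>

lemma curv_constant_L_sectional_curvature:
  assumes c: "constant_L_sectional_curvature A g s \<xi> nabla_ss c"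
  shows "curv p u v v u = c * (g p (f p u) (f p u) * g p (f p v) (f p v) - (g p (f p u) (f p v))\<^sup>2)
    + (eta_sum p v)\<^sup>2 * g p (f p u) (f p u) + (eta_sum p u)\<^sup>2 * g p (f p v) (f p v)
    - 2 * eta_sum p u * eta_sum p v * g p (f p u) (f p v)"
proof -
  interpret C: algebraic_curvature "curv p" by (rule algebraic_curvature_curv)
  define u' where "u' = - f p (f p u)"
  define v' where "v' = - f p (f p v)"
  have f': "f p u' = f p u" "f p v' = f p v" by (simp_all add: u'_def v'_def f_simps f_f_f)
  have e': "eta_sum p u' = 0" "eta_sum p v' = 0"
    by (simp_all add: u'_def v'_def linear_neg[OF eta_sum_linear] eta_sum_f)
  have L: "u' \<in> L_distribution g s \<xi> p" "v' \<in> L_distribution g s \<xi> p"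
    using L_scaleR[OF f_in_L[of p "f p u"], of "-1"] L_scaleR[OF f_in_L[of p "f p v"], of "-1"]
    by (simp_all add: u'_def v'_def)
  have "curv p u v v u = curv p u v v' u
      + eta_sum p v * (eta_sum p v * g p (f p u) (f p u) - eta_sum p u * g p (f p v) (f p u))"
    unfolding v'_def by (rule curv_decomposition_3)
  moreover have "curv p u v v' u = - curv p u v u v'" by (rule C.skew34)
  moreover have "curv p u v u v' = curv p u v u' v'
      + eta_sum p u * (eta_sum p v * g p (f p u) (f p v) - eta_sum p u * g p (f p v) (f p v))"
    using curv_decomposition_3[of p u v u v'] by (simp add: u'_def[symmetric] f')
  moreover have "curv p u v u' v' = curv p u' v' u v" by (rule C.pair_symmetric)
  moreover have "curv p u' v' u v = curv p u' v' u' v"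
    using curv_decomposition_3[of p u' v' u v] by (simp add: u'_def[symmetric] e')
  moreover have "curv p u' v' u' v = - curv p u' v' v u'" by (rule C.skew34)
  moreover have "curv p u' v' v u' = curv p u' v' v' u'"
    using curv_decomposition_3[of p u' v' v u'] by (simp add: v'_def[symmetric] e')
  moreover have "curv p u' v' v' u' = c * (g p u' u' * g p v' v' - (g p u' v')\<^sup>2)"
    by (rule curv_of_constant_L_sectional_curvature[OF c L])
  moreover have "g p u' u' = g p (f p u) (f p u)" "g p v' v' = g p (f p v) (f p v)" "g p u' v' = g p (f p u) (f p v)"
    using L_metric_f_f[OF L(1), of u'] L_metric_f_f[OF L(2), of v'] L_metric_f_f[OF L(1), of v'] by (simp_all add: f')
  ultimately show ?thesis
    using metric_sym[of p "f p v" "f p u"] by (simp add: power2_eq_square algebra_simps)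
qed

text \<open>In an adapted frame the summands would be: \<open>n (2 n - 1)\<close> pairs in L of
  curvature \<open>c\<close>, \<open>2 n s\<close> pairs of one vector of L and one structure field
  of Riemannian curvature 1, and half the sum of \<open>eta_sum p (e j)\<close> squared over ordered
  pairs of distinct indices.\<close>

theorem scalar_curvature_nabla_ss:
  fixes c :: real
  assumes c: "constant_L_sectional_curvature A g s \<xi> nabla_ss c"
    and e: "orthonormal_frame_at g p e"
  shows "scalar_curvature A g nabla_ss p e 
    = c * real n * (2 * real n - 1) + real s * (2 * real n) + real s * (2 * real n + real s - 1) / 2"
proof -
  let ?I = "{1..DIM('e)}"
  define h where "h i j = g p (f p (e i)) (f p (e j))" for i j
  define t where "t i = eta_sum p (e i)" for i
  note P = parseval[OF e]
  \<comment> \<open>Writing \<open>h\<close> and \<open>t\<close> as products of fixed vectors with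
    \<open>e i\<close> is what allows \<open>P\<close> to sum over \<open>i\<close>.\<close>
  have h_left: "h i j = g p (- f p (f p (e j))) (e i)" for i j
    using metric_ff[of p "e j" "e i"] metric_sym[of p "f p (e i)" "f p (e j)"] by (simp add: h_def metric_simps)
  have t_left: "t i = g p (xi_sum p) (e i)" for i
    using metric_sym[of p "e i"] by (simp add: t_def eta_sum_metric)
  have tt: "(\<Sum>i\<in>?I. t i * t i) = s"
  proof -
    have "(\<Sum>i\<in>?I. t i * t i) = eta_sum p (xi_sum p)"
      unfolding t_left P by (simp add: eta_sum_metric)
    also have "\<dots> = s"
      by (simp add: xi_sum_def linear_sum[OF eta_sum_linear] eta_sum_xi)
    finally show ?thesis .
  qed
  have eta_norm: "(\<Sum>i\<in>?I. \<eta> \<alpha> p (e i) * \<eta> \<alpha> p (e i)) = 1" if "\<alpha> \<in> {1..s}" for \<alpha>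
  proof -
    have eta: "\<eta> \<alpha> p v = g p (\<xi> \<alpha> p) v" for v
      using eta_metric[OF that] metric_sym by metis
    show ?thesis unfolding eta P using eta_xi[OF that that, of p] unfolding eta by simp
  qed
  have gii: "(\<Sum>i\<in>?I. g p (e i) (e i)) = DIM('e)"
    using e by (simp add: orthonormal_frame_at_def)
  have tr: "(\<Sum>i\<in>?I. h i i) = 2 * real n"
  proof -
    have "(\<Sum>i\<in>?I. h i i) = DIM('e) - (\<Sum>\<alpha>=1..s. \<Sum>i\<in>?I. \<eta> \<alpha> p (e i) * \<eta> \<alpha> p (e i))"
      unfolding h_def metric_f_f sum_subtractf gii by (subst sum.swap) simp
    also have "(\<Sum>\<alpha>=1..s. \<Sum>i\<in>?I. \<eta> \<alpha> p (e i) * \<eta> \<alpha> p (e i)) = s"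
      using sum.cong[OF refl eta_norm, of "{1..s}"] by simp
    finally show ?thesis using dimension by simp
  qed
  have hh: "(\<Sum>i\<in>?I. h i j * h i j) = h j j" for j
  proof -
    have "(\<Sum>i\<in>?I. h i j * h i j) = g p (f p (f p (e j))) (f p (f p (e j)))"
      unfolding h_left P by (simp add: metric_simps)
    then show ?thesis using L_metric_f_f[OF f_in_L, of p "e j" "f p (e j)"] by (simp add: h_def)
  qed
  have th: "(\<Sum>i\<in>?I. t i * h i j) = 0" for j
    unfolding t_left h_left P using eta_sum_f[of p "f p (e j)"] metric_sym[of p "xi_sum p"]
    by (simp add: metric_simps eta_sum_metric)
  have skew: "(\<Sum>j\<in>?I. g p (f p (e i)) (e j) * g p (e i) (e j)) = 0" for i
    unfolding P using metric_f_self[of p "e i"] metric_sym[of p "e i"] by simp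
  have tg: "(\<Sum>j\<in>?I. t j * g p (e i) (e j)) = t i" for i
    unfolding t_left P ..
  have "(\<Sum>i\<in>?I. \<Sum>j\<in>?I. sectional_curvature A g nabla_ss p (e i) (e j))
      = (\<Sum>i\<in>?I. \<Sum>j\<in>?I. c * (h i i * h j j) - c * (h i j * h i j) + t j * t j * h i i + t i * t i * h j j
        - 2 * (t j * (t i * h i j)) - s * (g p (f p (e i)) (e j) * g p (e i) (e j))
        + t j * t j * g p (e i) (e i) - t i * (t j * g p (e i) (e j)))"
    by (intro sum.cong refl)
      (simp add: sectional_curvature_nabla_ss curv_constant_L_sectional_curvature[OF c] h_def t_def
        power2_eq_square algebra_simps)
  also have "\<dots> = c * ((\<Sum>i\<in>?I. h i i) * (\<Sum>j\<in>?I. h j j)) - c * (\<Sum>j\<in>?I. \<Sum>i\<in>?I. h i j * h i j)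
      + (\<Sum>j\<in>?I. t j * t j) * (\<Sum>i\<in>?I. h i i) + (\<Sum>i\<in>?I. t i * t i) * (\<Sum>j\<in>?I. h j j)
      - 2 * (\<Sum>j\<in>?I. t j * (\<Sum>i\<in>?I. t i * h i j))
      - s * (\<Sum>i\<in>?I. \<Sum>j\<in>?I. g p (f p (e i)) (e j) * g p (e i) (e j))
      + (\<Sum>j\<in>?I. t j * t j) * (\<Sum>i\<in>?I. g p (e i) (e i))
      - (\<Sum>i\<in>?I. t i * (\<Sum>j\<in>?I. t j * g p (e i) (e j)))"
  proof -
    have "(\<Sum>i\<in>?I. \<Sum>j\<in>?I. c * (h i i * h j j)) = c * ((\<Sum>i\<in>?I. h i i) * (\<Sum>j\<in>?I. h j j))"
      unfolding sum_product by (simp only: sum_distrib_left)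
    moreover have "(\<Sum>i\<in>?I. \<Sum>j\<in>?I. c * (h i j * h i j)) = c * (\<Sum>j\<in>?I. \<Sum>i\<in>?I. h i j * h i j)"
      by (subst sum.swap) (simp only: sum_distrib_left)
    moreover have "(\<Sum>i\<in>?I. \<Sum>j\<in>?I. t j * t j * b i) = (\<Sum>j\<in>?I. t j * t j) * (\<Sum>i\<in>?I. b i)" for b :: "nat \<Rightarrow> real"
      by (subst sum.swap) (simp only: sum_product)
    moreover have "(\<Sum>i\<in>?I. \<Sum>j\<in>?I. t i * t i * h j j) = (\<Sum>i\<in>?I. t i * t i) * (\<Sum>j\<in>?I. h j j)"
      by (simp only: sum_product)
    moreover have "(\<Sum>i\<in>?I. \<Sum>j\<in>?I. 2 * (t j * (t i * h i j))) = 2 * (\<Sum>j\<in>?I. t j * (\<Sum>i\<in>?I. t i * h i j))"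
      by (subst sum.swap) (simp only: sum_distrib_left)
    ultimately show ?thesis
      by (simp only: sum.distrib sum_subtractf) (simp only: sum_distrib_left)
  qed
  also have "\<dots> = c * (2 * real n * (2 * real n)) - c * (2 * real n) + real s * (2 * real n)
      + real s * (2 * real n) + real s * (2 * real n + real s) - real s"
    unfolding hh tt th skew tg gii tr by (simp add: dimension)
  finally show ?thesis
    by (simp add: scalar_curvature_def field_simps)
qed

end

theorem mainTheorem7:
  fixes A :: "('a::{t2_space, second_countable_topology}, 'e::euclidean_space) chart set"
    and g :: "'a \<Rightarrow> 'e \<Rightarrow> 'e \<Rightarrow> real"
    and n s :: nat
    and f :: "'a \<Rightarrow> 'e \<Rightarrow> 'e"
    and \<xi> :: "nat \<Rightarrow> 'a \<Rightarrow> 'e"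
    and \<eta> :: "nat \<Rightarrow> 'a \<Rightarrow> 'e \<Rightarrow> real"
    and nabla nabla' :: "('a, 'e) connection"
    and c :: real
  assumes "S_manifold A g n s f \<xi> \<eta>"
    and "n \<ge> 2"
    and "levi_civita_connection A g nabla"
    and "nabla' = semi_symmetric_non_metric_connection s \<eta> nabla"
    and "constant_L_sectional_curvature A g s \<xi> nabla' c"
  shows "c = real s \<and>
    (\<forall>p e. orthonormal_frame_at g p e \<longrightarrow>
       scalar_curvature A g nabla' p e = 2 * real n * real s * (real n + 1) + real s * (real s - 1) / 2)"
proof -
  interpret S: S_manifold A g n s f \<xi> \<eta> by (rule assms(1))
  interpret S_levi_civita_manifold A g n s f \<xi> \<eta> nabla
    by unfold_locales (rule assms(3))
  note c = assms(5)[unfolded assms(4)]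
  have "c = s" by (rule constant_L_sectional_curvature_value[OF c assms(2)])
  moreover have "scalar_curvature A g nabla' p e = 2 * real n * real s * (real n + 1) + real s * (real s - 1) / 2"
    if "orthonormal_frame_at g p e" for p e
    using scalar_curvature_nabla_ss[OF c that] \<open>c = s\<close> by (simp add: assms(4) field_simps)
  ultimately show ?thesis by blast
qed

end
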